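(* Let $w\in\mathbf R^n$ be a generic weight vector and let $\beta\in\mathbf k^d$. Given a face $\tau\in\Delta_w$, there exist at least $|E_\tau(\beta)|\cdot{\rm vol}(\tau)$ many logarithm-free canonical series solutions $\phi_v$ to $M_A(\beta)$ with respect to $w$ satisfying $\sum_{j:\,a_j\in\tau}v_ja_j\in E_\tau(\beta)$ (i.e. this vector represents an element of $E_\tau(\beta)$), ${\rm nsupp}(v)\subset{\rm vert}(\tau)$, and $\{\,j : v_j\notin\mathbf Z\,\}\subset{\rm vert}(\tau)$.
   Context: Let $\mathbf N=\{0,1,2,\dots\}$ and let $\mathbf k$ be a field of characteristic zero. Let $A=(a_1,\dots,a_n)=(a_{ij})$ be a $d\times n$ integer matrix of rank $d$ whose columns all lie on one hyperplane of $\mathbf Q^d$ not containing the origin; $A$ also denotes the set of its columns, and $\mathbf NA$ the monoid they generate. Put $L=\{u\in\mathbf Z^n : Au=0\}$. Hypergeometric system: $I_A=\langle \partial^u-\partial^v : u,v\in\mathbf N^n,\ Au=Av\rangle\subset\mathbf k[\partial]=\mathbf k[\partial_1,\dots,\partial_n]$. For $\beta\in\mathbf k^d$, $H_A(\beta)$ is the left ideal of the Weyl algebra $D=\mathbf k\langle x_1,\dots,x_n,\partial_1,\dots,\partial_n\rangle$ generated by $I_A$ and $\sum_{j}a_{ij}\theta_j-\beta_i$ ($i=1,\dots,d$), $\theta_j=x_j\partial_j$; $M_A(\beta)=D/H_A(\beta)$. A formal series annihilated by $H_A(\beta)$ is called $A$-hypergeometric with parameter $\beta$, or a series solution to $M_A(\beta)$.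 Weights: $\partial_j$ has $w$-weight $w_j$, and ${\rm in}_w(I_A)$ is the ideal generated by the initial forms (parts of highest $w$-weight) of elements of $I_A$. Generic means that the initial ideals ${\rm in}_w(I_A)$ and ${\rm in}_{(-w,w)}(H_A(\beta))$ do not change under small perturbations of $w$ (so ${\rm in}_w(I_A)$ is a monomial ideal). $\Delta_w$ is the regular triangulation of ${\rm conv}(A)$ determined by $w$: ${\rm conv}\{a_j : j\in I\}$ is a face of $\Delta_w$ with vertices $a_j$ ($j\in I$) iff there is $c\in\mathbf R^d$ with $c\cdot a_j=w_j$ for $j\in I$ and $c\cdot a_j<w_j$ for $j\notin I$; $\emptyset$ is also a face. Series: consider an $A$-hypergeometric series $x^v\sum_{u\in L}g_u(\log x)x^u$ with $v\in\mathbf k^n$, $g_u\in\mathbf k[x_1,\dots,x_n]$, $\log x=(\log x_1,\dots,\log x_n)$. It is in the direction of $w$ if there is a basis $u^{(1)},\dots,u^{(n)}$ of $\mathbf Q^n$ with $w\cdot u^{(j)}>0$ for all $j$ and $g_u=0$ for $u\notin\sum_j\mathbf Q_{\ge0}u^{(j)}$. If moreover $g_0\ne0$, then $x^v\cdot{\rm in}_\prec(g_0)(\log x)$, with $\prec$ the lexicographic order, is its starting monomial. Such a series is canonical with respect to $w$ if no starting monomial (of any $A$-hypergeometric series with parameter $\beta$ in the direction of $w$) other than its own $x^v\cdot{\rm in}_\prec(g_0)(\log x)$ appears in it. It is logarithm-free if all $g_u$ are constants. The series $\phi_v$: for $v\in\mathbf k^n$, ${\rm nsupp}(v)=\{i :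 v_i\in\mathbf Z_{<0}\}$; $v$ has minimal negative support if ${\rm nsupp}(v)$ is minimal under inclusion among ${\rm nsupp}(v+u)$, $u\in L$. For such $v$ with $Av=\beta$, put $\phi_v=x^v\sum_{u\in N_v}\frac{[v]_{u_-}}{[v+u]_{u_+}}x^u$, where $N_v=\{u\in L : {\rm nsupp}(v)={\rm nsupp}(v+u)\}$, $u=u_+-u_-$ with $u_\pm\in\mathbf N^n$ of disjoint supports, and $[v]_t=\prod_{j}v_j(v_j-1)\cdots(v_j-t_j+1)$ for $t\in\mathbf N^n$. Faces: for a face $\tau$, $\mathbf Z(A\cap\tau)$ and $\mathbf k(A\cap\tau)$ are the additive group and the $\mathbf k$-vector space generated by $A\cap\tau$ (both $\{0\}$ for $\tau=\emptyset$), and $E_\tau(\beta)=\{\lambda\in\mathbf k(A\cap\tau)/\mathbf Z(A\cap\tau) : \beta-\lambda\in\mathbf NA+\mathbf Z(A\cap\tau)\}$, a finite set. ${\rm vert}(\tau)$ is the set of indices $j$ such that $a_j$ is a vertex of $\tau$, and ${\rm vol}(\tau)=[\mathbf Z(A\cap\tau):\sum_{i\in{\rm vert}(\tau)}\mathbf Za_i]$.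
   Formalization: The weight vector w is assumed nonzero; this follows from genericity when n > d, but for n = d the weight w = 0 is formally generic, no series is then in the direction of w, and the claim fails (e.g. n = d = 1, A = (1)). *)

theory Defs
  imports
    "HOL-Analysis.Analysis"
    "HOL-Library.Poly_Mapping"
    "HOL-Library.Set_Algebras"
    "HOL-Computational_Algebra.Group_Closure"
begin

definition nvec :: "nat^'n \<Rightarrow> ('a::semiring_1)^'n" where
  "nvec t = (\<chi> j. of_nat (t $ j))"

definition ivec :: "int^'n \<Rightarrow> ('a::ring_1)^'n" where
  "ivec u = (\<chi> j. of_int (u $ j))"

definition qvec :: "rat^'n \<Rightarrow> real^'n" where
  "qvec q = (\<chi> j. of_rat (q $ j))"

definition imat :: "int^'n^'d \<Rightarrow> ('a::ring_1)^'n^'d" where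
  "imat A = map_matrix of_int A"

definition pos_part :: "int^'n \<Rightarrow> nat^'n" where
  "pos_part u = (\<chi> j. nat (u $ j))"

definition neg_part :: "int^'n \<Rightarrow> nat^'n" where
  "neg_part u = (\<chi> j. nat (- (u $ j)))"

definition kernel_lattice :: "int^'n^'d \<Rightarrow> (int^'n) set" where
  "kernel_lattice A = {u. A *v u = 0}"

definition on_hyperplane_off_origin :: "int^'n^'d \<Rightarrow> bool" where
  "on_hyperplane_off_origin A \<longleftrightarrow>
     (\<exists>(h::rat^'d) c. h \<noteq> 0 \<and> c \<noteq> 0 \<and> (\<forall>j. (\<Sum>i\<in>UNIV. h $ i * of_int (A $ i $ j)) = c))"

text \<open>A commutative polynomial in the variables indexed by \<^typ>\<open>'n\<close> is a finitely supported
  function on exponent vectors, multiplied by the convolution product of \<^theory>\<open>HOL-Library.Poly_Mapping\<close>.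
  This type is used both for the ring of the partial derivatives and for the polynomials
  in the logarithms.\<close>

type_synonym ('n, 'k) pol = "(nat^'n) \<Rightarrow>\<^sub>0 'k"

abbreviation monomial :: "'a \<Rightarrow> 'a \<Rightarrow>\<^sub>0 'k::{zero,one}" where
  "monomial t \<equiv> Poly_Mapping.single t 1"

definition const :: "'k \<Rightarrow> ('n::finite, 'k::zero) pol" where
  "const c = Poly_Mapping.single 0 c"

definition pdiff :: "'n \<Rightarrow> ('n::finite, 'k::comm_ring_1) pol \<Rightarrow> ('n, 'k) pol" where
  "pdiff i g = (\<Sum>t\<in>Poly_Mapping.keys g.
     Poly_Mapping.single (t - axis i 1) (of_nat (t $ i) * Poly_Mapping.lookup g t))"

text \<open>An element of the Weyl algebra is given by its normally ordered expansion: the key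
  \<open>(a, b)\<close> stands for \<open>x^a \<partial>^b\<close>.  The product is \<open>weyl_mult\<close>, not the commutative
  convolution \<open>*\<close> which this type also carries.\<close>

type_synonym ('n, 'k) weyl = "((nat^'n) \<times> (nat^'n)) \<Rightarrow>\<^sub>0 'k"

text \<open>The Leibniz rule \<open>\<partial>^b x^c = (\<Sum>k. k! (b choose k) (c choose k) x^(c-k) \<partial>^(b-k))\<close>
  in multi-index notation.\<close>

definition weyl_mult :: "('n::finite, 'k::comm_ring_1) weyl \<Rightarrow> ('n, 'k) weyl \<Rightarrow> ('n, 'k) weyl" where
  "weyl_mult P Q =
    (\<Sum>(a, b)\<in>Poly_Mapping.keys P. \<Sum>(c, e)\<in>Poly_Mapping.keys Q. \<Sum>k | k \<le> b \<and> k \<le> c.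
       Poly_Mapping.single (a + (c - k), (b - k) + e)
         (Poly_Mapping.lookup P (a, b) * Poly_Mapping.lookup Q (c, e) *
          of_nat (\<Prod>i\<in>UNIV. fact (k $ i) * (b $ i choose k $ i) * (c $ i choose k $ i))))"

inductive_set left_ideal :: "('n::finite, 'k::comm_ring_1) weyl set \<Rightarrow> ('n, 'k) weyl set"
  for S :: "('n, 'k) weyl set" where
  base: "P \<in> S \<Longrightarrow> P \<in> left_ideal S"
| zero: "0 \<in> left_ideal S"
| add: "P \<in> left_ideal S \<Longrightarrow> Q \<in> left_ideal S \<Longrightarrow> P + Q \<in> left_ideal S"
| mult: "Q \<in> left_ideal S \<Longrightarrow> weyl_mult P Q \<in> left_ideal S"

definition weyl_of_pol :: "('n::finite, 'k::comm_ring_1) pol \<Rightarrow> ('n, 'k) weyl" where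
  "weyl_of_pol p =
     (\<Sum>t\<in>Poly_Mapping.keys p. Poly_Mapping.single (0, t) (Poly_Mapping.lookup p t))"

definition ideal_of :: "'a::comm_ring_1 set \<Rightarrow> 'a set" where
  "ideal_of S = module.span (*) S"

definition toric_ideal :: "int^'n^'d \<Rightarrow> ('n::finite, 'k::comm_ring_1) pol set" where
  "toric_ideal A = ideal_of {monomial u - monomial v | u v. A *v nvec u = A *v nvec v}"

definition euler_op :: "int^'n^'d \<Rightarrow> 'k^'d \<Rightarrow> 'd \<Rightarrow> ('n::finite, 'k::comm_ring_1) weyl" where
  "euler_op A \<beta> i =
     (\<Sum>j\<in>UNIV. Poly_Mapping.single (axis j 1, axis j 1) (of_int (A $ i $ j)))
       - Poly_Mapping.single (0, 0) (\<beta> $ i)"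

definition hyp_ideal :: "int^'n^'d \<Rightarrow> 'k^'d \<Rightarrow> ('n::finite, 'k::comm_ring_1) weyl set" where
  "hyp_ideal A \<beta> = left_ideal (weyl_of_pol ` toric_ideal A \<union> range (euler_op A \<beta>))"

definition initial_form :: "('a \<Rightarrow> real) \<Rightarrow> ('a \<Rightarrow>\<^sub>0 'k::comm_monoid_add) \<Rightarrow> 'a \<Rightarrow>\<^sub>0 'k" where
  "initial_form wt p =
     (\<Sum>t | t \<in> Poly_Mapping.keys p \<and> (\<forall>s\<in>Poly_Mapping.keys p. wt s \<le> wt t).
        Poly_Mapping.single t (Poly_Mapping.lookup p t))"

definition initial_ideal :: "real^'n \<Rightarrow> ('n::finite, 'k::comm_ring_1) pol set \<Rightarrow> ('n, 'k) pol set" where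
  "initial_ideal w J = ideal_of (initial_form (\<lambda>t. w \<bullet> nvec t) ` J)"

text \<open>The initial ideal for the weight \<open>(-w, w)\<close>: here \<open>x_j\<close> has weight \<open>-w_j\<close> and
  \<open>\<partial>_j\<close> has weight \<open>w_j\<close>.  As the weights of \<open>x_j\<close> and \<open>\<partial>_j\<close> add up to \<open>0\<close>, the initial
  forms are again elements of the Weyl algebra.\<close>

definition weyl_initial_ideal :: "real^'n \<Rightarrow> ('n::finite, 'k::comm_ring_1) weyl set \<Rightarrow> ('n, 'k) weyl set" where
  "weyl_initial_ideal w J = left_ideal (initial_form (\<lambda>(a, b). w \<bullet> nvec b - w \<bullet> nvec a) ` J)"

definition generic_weight :: "int^'n^'d \<Rightarrow> ('k::comm_ring_1)^'d \<Rightarrow> real^'n \<Rightarrow> bool" where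
  "generic_weight A \<beta> w \<longleftrightarrow>
     (\<forall>\<^sub>F w' in nhds w.
        initial_ideal w' (toric_ideal A :: ('n::finite, 'k) pol set) = initial_ideal w (toric_ideal A) \<and>
        weyl_initial_ideal w' (hyp_ideal A \<beta>) = weyl_initial_ideal w (hyp_ideal A \<beta>))"

text \<open>A face of the regular triangulation is represented by the set \<open>I\<close> of the indices
  of its vertices.\<close>

definition regular_faces :: "int^'n^'d \<Rightarrow> real^'n \<Rightarrow> 'n set set" where
  "regular_faces A w = {I. I = {} \<or>
     (\<exists>c::real^'d. (\<forall>j\<in>I. c \<bullet> ivec (column j A) = w $ j) \<and>
                   (\<forall>j. j \<notin> I \<longrightarrow> c \<bullet> ivec (column j A) < w $ j))}"

definition face_indices :: "int^'n^'d \<Rightarrow> 'n set \<Rightarrow> 'n set" where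
  "face_indices A I =
     {j. (ivec (column j A) :: real^'d) \<in> convex hull ((\<lambda>i. ivec (column i A)) ` I)}"

text \<open>The value \<open>f \<gamma>\<close> of a series is the polynomial \<open>g\<close> for which \<open>x^\<gamma> g(log x)\<close> is the part
  of \<open>f\<close> with exponent \<open>\<gamma>\<close>.  A series \<open>x^v (\<Sum>u\<in>L. g_u(log x) x^u)\<close> thus has
  \<open>g_u = f (v + ivec u)\<close>.\<close>

type_synonym ('n, 'k) logseries = "'k^'n \<Rightarrow> ('n, 'k) pol"

text \<open>\<open>\<partial>_i (x^\<gamma> g(log x)) = x^(\<gamma> - e_i) (\<gamma>_i g + \<partial>g/\<partial>y_i)(log x)\<close>\<close>

definition series_diff :: "'n \<Rightarrow> ('n::finite, 'k::comm_ring_1) logseries \<Rightarrow> ('n, 'k) logseries" where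
  "series_diff i f = (\<lambda>\<gamma>. const (\<gamma> $ i + 1) * f (\<gamma> + axis i 1) + pdiff i (f (\<gamma> + axis i 1)))"

text \<open>The operators \<open>series_diff i\<close> commute, so the order of the indices plays no role.\<close>

definition series_diffs ::
    "nat^('n::{finite,linorder}) \<Rightarrow> ('n::{finite,linorder}, 'k::comm_ring_1) logseries \<Rightarrow> ('n, 'k) logseries" where
  "series_diffs b f = fold (\<lambda>i. series_diff i ^^ (b $ i)) (sorted_list_of_set UNIV) f"

definition weyl_apply ::
    "('n::{finite,linorder}, 'k::comm_ring_1) weyl \<Rightarrow> ('n, 'k) logseries \<Rightarrow> ('n, 'k) logseries" where
  "weyl_apply P f = (\<lambda>\<gamma>. \<Sum>(a, b)\<in>Poly_Mapping.keys P.
     const (Poly_Mapping.lookup P (a, b)) * series_diffs b f (\<gamma> - nvec a))"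

definition hypergeometric ::
    "int^('n::{finite,linorder})^'d \<Rightarrow> 'k^'d \<Rightarrow> ('n::{finite,linorder}, 'k::comm_ring_1) logseries \<Rightarrow> bool" where
  "hypergeometric A \<beta> f \<longleftrightarrow> (\<forall>P\<in>hyp_ideal A \<beta>. weyl_apply P f = (\<lambda>_. 0))"

definition rat_cone :: "(rat^'n) set \<Rightarrow> (rat^'n) set" where
  "rat_cone B = {\<Sum>b\<in>B. c b *s b | c. \<forall>b\<in>B. 0 \<le> c b}"

definition in_direction ::
    "int^'n^'d \<Rightarrow> real^'n \<Rightarrow> 'k^'n \<Rightarrow> ('n::finite, 'k::comm_ring_1) logseries \<Rightarrow> bool" where
  "in_direction A w v f \<longleftrightarrow>
     (\<exists>B. vec.independent B \<and> vec.span B = UNIV \<and> (\<forall>b\<in>B. w \<bullet> qvec b > 0) \<and>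
        (\<forall>\<gamma>. f \<gamma> \<noteq> 0 \<longrightarrow> (\<exists>u\<in>kernel_lattice A. \<gamma> = v + ivec u \<and> ivec u \<in> rat_cone B)))"

text \<open>Exponent of the lexicographically largest monomial of a nonzero polynomial, where
  the variable with the smallest index is the largest one.\<close>

definition lex_lead :: "('n::{finite,linorder}, 'k::zero) pol \<Rightarrow> nat^('n::{finite,linorder})" where
  "lex_lead g = (THE t. t \<in> Poly_Mapping.keys g \<and>
     (\<forall>s\<in>Poly_Mapping.keys g. s \<noteq> t \<longrightarrow> less_fun (($) s) (($) t)))"

text \<open>The pair \<open>(\<gamma>, b)\<close> stands for the monomial \<open>x^\<gamma> (log x)^b\<close>.\<close>

definition starting_monomials ::
    "int^('n::{finite,linorder})^'d \<Rightarrow> ('k::comm_ring_1)^'d \<Rightarrow> real^('n::{finite,linorder}) \<Rightarrow>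
     (('k, 'n) vec \<times> (nat, 'n) vec) set" where
  "starting_monomials A \<beta> w =
     {(v, lex_lead (f v)) | v f. hypergeometric A \<beta> f \<and> in_direction A w v f \<and> f v \<noteq> 0}"

definition canonical ::
    "int^('n::{finite,linorder})^'d \<Rightarrow> 'k^'d \<Rightarrow> real^('n::{finite,linorder}) \<Rightarrow>
     'k^('n::{finite,linorder}) \<Rightarrow> ('n::{finite,linorder}, 'k::comm_ring_1) logseries \<Rightarrow> bool"
    where
  "canonical A \<beta> w v f \<longleftrightarrow> hypergeometric A \<beta> f \<and> in_direction A w v f \<and> f v \<noteq> 0 \<and>
     (\<forall>(\<gamma>, b)\<in>starting_monomials A \<beta> w.
        b \<in> Poly_Mapping.keys (f \<gamma>) \<longrightarrow> (\<gamma>, b) = (v, lex_lead (f v)))"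

definition log_free :: "('n::finite, 'k::zero) logseries \<Rightarrow> bool" where
  "log_free f \<longleftrightarrow> (\<forall>\<gamma>. \<exists>c. f \<gamma> = const c)"

definition nsupp :: "('k::ring_1)^'n \<Rightarrow> 'n set" where
  "nsupp v = {i. \<exists>m::int. m < 0 \<and> v $ i = of_int m}"

definition minimal_nsupp :: "int^'n^'d \<Rightarrow> ('k::ring_1)^'n \<Rightarrow> bool" where
  "minimal_nsupp A v \<longleftrightarrow> (\<forall>u\<in>kernel_lattice A. \<not> nsupp (v + ivec u) \<subset> nsupp v)"

definition falling :: "('k::comm_ring_1)^'n \<Rightarrow> nat^'n \<Rightarrow> 'k" where
  "falling v t = (\<Prod>j\<in>UNIV. \<Prod>m<t $ j. v $ j - of_nat m)"

definition nsupp_class :: "int^'n^'d \<Rightarrow> ('k::ring_1)^'n \<Rightarrow> (int^'n) set" where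
  "nsupp_class A v = {u\<in>kernel_lattice A. nsupp (v + ivec u) = nsupp v}"

text \<open>In characteristic \<open>0\<close> the sum has at most one term.\<close>

definition phi :: "int^'n^'d \<Rightarrow> ('k::field_char_0)^'n \<Rightarrow> ('n::finite, 'k) logseries" where
  "phi A v = (\<lambda>\<gamma>. \<Sum>u | u \<in> nsupp_class A v \<and> v + ivec u = \<gamma>.
     const (falling v (neg_part u) / falling (v + ivec u) (pos_part u)))"

definition monoid_of :: "int^'n^'d \<Rightarrow> (('k::ring_1)^'d) set" where
  "monoid_of A = range (\<lambda>t. imat A *v nvec t)"

definition face_group :: "int^'n^'d \<Rightarrow> 'n set \<Rightarrow> (('k::field)^'d) set" where
  "face_group A I = group_closure ((\<lambda>j. ivec (column j A)) ` face_indices A I)"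

definition face_space :: "int^'n^'d \<Rightarrow> 'n set \<Rightarrow> (('k::field)^'d) set" where
  "face_space A I = vec.span ((\<lambda>j. ivec (column j A)) ` face_indices A I)"

text \<open>The elements of the quotient are the cosets \<open>\<mu> +o face_group A I\<close>.\<close>

definition E_set :: "int^'n^'d \<Rightarrow> 'n set \<Rightarrow> ('k::field)^'d \<Rightarrow> ('k^'d) set set" where
  "E_set A I \<beta> = {\<mu> +o face_group A I | \<mu>.
     \<mu> \<in> face_space A I \<and> \<beta> - \<mu> \<in> monoid_of A + face_group A I}"

definition face_vol :: "int^'n^'d \<Rightarrow> 'n set \<Rightarrow> nat" where
  "face_vol A I = card ((\<lambda>z. z +o group_closure ((\<lambda>i. column i A) ` I)) `
     group_closure ((\<lambda>j. column j A) ` face_indices A I))"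

end

theory Submission
  imports Defs
begin

text \<open>Let \<open>I\<close> be the vertex set of the face, \<open>G\<close> the group generated by the columns on the face and \<open>H\<close> the
one generated by the columns in \<open>I\<close>, and let \<open>L\<close> be the integer kernel of \<open>A\<close>.  A class \<open>\<mu> + G\<close> in
\<open>E_set A I \<beta>\<close> splits into as many classes \<open>\<mu> + g + H\<close> as the index \<open>[G : H]\<close>, and each of these fixes the
fractional part of the coordinates in \<open>I\<close> of an exponent \<open>v\<close> with \<open>Av = \<beta>\<close> that has natural coordinates
outside \<open>I\<close>.  Such a \<open>v\<close> exists because \<open>G\<close> is contained in the sum of \<open>H\<close> and the monoid generated by all
columns (\<open>exists_fiber_point\<close>), and distinct classes give exponents that are not congruent modulo \<open>L\<close>.

Within each class \<open>v + L\<close> choose \<open>v\<close>, with natural coordinates outside \<open>I\<close>, such that its negative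
support is minimal and, subject to that, its \<open>w\<close>-weight is minimal (\<open>exists_minimal_exponent\<close>).  The
minimum exists because on \<open>L\<close> the weight agrees with a form that vanishes on the coordinates in \<open>I\<close>
and is positive on the others, and the coordinates outside \<open>I\<close> determine a vector of \<open>L\<close>
(\<open>weight_bound\<close>).  Genericity makes the minimum strict: if \<open>w \<bullet> u = 0\<close> for some nonzero \<open>u\<close> in \<open>L\<close>, then
\<open>\<partial>^(u_+)\<close> lies in the initial ideal, so \<open>u_+\<close> can be replaced by an exponent of smaller weight
(\<open>generic_not_fiber_min\<close>).  Hence \<open>w\<close> is positive, and even at least a multiple of the norm, on the
nonzero \<open>u\<close> for which \<open>x^(v + u)\<close> occurs in \<open>phi A v\<close>.  A closed cone of this kind fits into a simplicial
rational cone on which \<open>w\<close> is positive (\<open>rational_cone_basis\<close>), so \<open>phi A v\<close> is in the direction of \<open>w\<close>.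

The series \<open>phi A v\<close> is annihilated by the hypergeometric ideal (\<open>hypergeometric_phi\<close>).  For
logarithm-free series the Weyl algebra acts on coefficient functions through falling factorials,
compatibly with the product by the Chu--Vandermonde identity, so that only the generators have to be
checked.  The series is canonical (\<open>canonical_phi\<close>), since a series starting at another monomial
\<open>x^(v + u)\<close> of \<open>phi A v\<close> in the direction of \<open>w\<close> would have to contain terms with exponent \<open>v\<close>, which have
smaller weight.\<close>

section \<open>Vectors over the natural numbers and the integers\<close>

lemma nvec_nth [simp]: "nvec t $ j = of_nat (t $ j)"
  by (simp add: nvec_def)

lemma ivec_nth [simp]: "ivec u $ j = of_int (u $ j)"
  by (simp add: ivec_def)

lemma nvec_add: "nvec (s + t) = nvec s + nvec t"
  by (simp add: vec_eq_iff)

lemma ivec_add: "ivec (s + t) = ivec s + ivec t"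
  by (simp add: vec_eq_iff)

lemma ivec_diff: "ivec (s - t) = ivec s - ivec t"
  by (simp add: vec_eq_iff)

lemma ivec_eq_iff [simp]: "(ivec u :: 'a::ring_char_0^'n) = ivec v \<longleftrightarrow> u = v"
  by (auto simp: vec_eq_iff)

lemma ivec_0 [simp]: "ivec 0 = 0"
  by (simp add: vec_eq_iff)

lemma nvec_0 [simp]: "nvec 0 = 0"
  by (simp add: vec_eq_iff)

lemma ivec_nvec [simp]: "ivec (nvec t) = nvec t"
  by (simp add: vec_eq_iff)

lemma nvec_pos_minus_neg: "nvec (pos_part u) - nvec (neg_part u) = (ivec u :: 'a::ring_1^'n)"
proof -
  have "of_nat (nat z) - of_nat (nat (- z)) = (of_int z :: 'a)" for z
    by (cases "z \<ge> 0") (simp_all add: of_nat_nat)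
  then show ?thesis
    by (simp add: vec_eq_iff pos_part_def neg_part_def)
qed

lemma matrix_nvec_pos_part:
  assumes "u \<in> kernel_lattice A"
  shows "A *v nvec (pos_part u) = A *v nvec (neg_part u)"
proof -
  have "A *v (nvec (pos_part u) - nvec (neg_part u)) = 0"
    using assms by (simp add: nvec_pos_minus_neg kernel_lattice_def) (simp add: ivec_def vec_lambda_eta)
  then show ?thesis
    by (simp add: matrix_vector_mult_diff_distrib)
qed

lemma imat_ivec: "imat A *v ivec u = ivec (A *v u)"
  by (simp add: vec_eq_iff imat_def map_matrix_def matrix_vector_mult_def)

section \<open>The initial ideal of the toric ideal\<close>

lemma poly_mapping_monomial_induct [case_names zero add single]:
  assumes "P 0" and "\<And>p q. P p \<Longrightarrow> P q \<Longrightarrow> P (p + q)" and "\<And>t c. P (Poly_Mapping.single t c)"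
  shows "P (p :: 'a \<Rightarrow>\<^sub>0 'b::comm_monoid_add)"
proof (induction p rule: update_induct)
  case const
  show ?case by (rule assms(1))
next
  case (update p a b)
  have "Poly_Mapping.update a b p = p + Poly_Mapping.single a b"
    using update(1)
    by (intro poly_mapping_eqI) (auto simp: lookup_update lookup_add lookup_single when_def in_keys_iff)
  then show ?case using update assms by metis
qed

lemma module_mult: "module ((*) :: 'a::comm_ring_1 \<Rightarrow> 'a \<Rightarrow> 'a)"
  by unfold_locales (simp_all add: algebra_simps)

text \<open>The toric ideal is spanned as a vector space by the multiples \<open>c (\<partial>^u - \<partial>^v)\<close> of its binomials:
multiplying a binomial by a monomial gives another one.\<close>

lemma toric_ideal_induct [consumes 1, case_names zero add binomial]:
  fixes p :: "('n::finite, 'k::comm_ring_1) pol"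
  assumes "p \<in> toric_ideal A" and "P 0" and add: "\<And>p q. P p \<Longrightarrow> P q \<Longrightarrow> P (p + q)"
    and binom: "\<And>u v c. A *v nvec u = A *v nvec v \<Longrightarrow>
      P (Poly_Mapping.single u c - Poly_Mapping.single v c)"
  shows "P p"
proof -
  interpret M: module "(*) :: ('n, 'k) pol \<Rightarrow> _"
    by (rule module_mult)
  have "P (q * (monomial u - monomial v))" if "A *v nvec u = A *v nvec v" for q u v
  proof (induction q rule: poly_mapping_monomial_induct)
    case zero
    show ?case using assms(2) by simp
  next
    case (add p q)
    then show ?case by (simp add: distrib_right assms(3))
  next
    case (single t c)
    show ?case
      using binom [of "t + u" "t + v" c] that
      by (simp add: right_diff_distrib mult_single nvec_add matrix_vector_right_distrib)
  qed
  then have gen: "P (q * b)" if "b \<in> {monomial u - monomial v | u v. A *v nvec u = A *v nvec v}" for q b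
    using that by auto
  show ?thesis
    using assms(1) unfolding toric_ideal_def ideal_of_def
    by (induction p rule: M.span_induct_alt) (use assms(2) add gen in auto)
qed

lemma binomial_in_toric_ideal:
  assumes "A *v nvec u = A *v nvec v"
  shows "monomial u - monomial v \<in> (toric_ideal A :: ('n::finite, 'k::comm_ring_1) pol set)"
proof -
  interpret M: module "(*) :: ('n, 'k) pol \<Rightarrow> _"
    by (rule module_mult)
  show ?thesis
    unfolding toric_ideal_def ideal_of_def by (rule M.span_base) (use assms in blast)
qed

text \<open>The linear functional that adds up the coefficients of the terms with exponent in \<open>S\<close>.\<close>

definition coeff_sum :: "'a set \<Rightarrow> ('a \<Rightarrow>\<^sub>0 'k::comm_monoid_add) \<Rightarrow> 'k" where
  "coeff_sum S p = (\<Sum>t\<in>Poly_Mapping.keys p. if t \<in> S then Poly_Mapping.lookup p t else 0)"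

lemma coeff_sum_add: "coeff_sum S (p + q) = coeff_sum S p + coeff_sum S q"
  unfolding coeff_sum_def by (rule setsum_keys_plus_distrib) auto

lemma coeff_sum_single: "coeff_sum S (Poly_Mapping.single t c) = (if t \<in> S then c else 0)"
  by (simp add: coeff_sum_def)

lemma coeff_sum_0 [simp]: "coeff_sum S 0 = 0"
  by (simp add: coeff_sum_def)

lemma coeff_sum_diff:
  "coeff_sum S (p - q) = coeff_sum S p - (coeff_sum S q :: 'k::ab_group_add)"
  using coeff_sum_add [of S "p - q" q] by simp

lemma coeff_sum_single_mult:
  "coeff_sum S (Poly_Mapping.single s c * p) = c * coeff_sum {t. s + t \<in> S} (p :: ('a::monoid_add \<Rightarrow>\<^sub>0 'k::comm_ring_1))"
  by (induction p rule: poly_mapping_monomial_induct)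
    (simp_all add: distrib_left coeff_sum_add mult_single coeff_sum_single)

lemma coeff_sum_toric_ideal:
  assumes "p \<in> toric_ideal A"
  shows "coeff_sum {t. A *v nvec t = z} p = (0 :: 'k::comm_ring_1)"
  using assms by (induction p rule: toric_ideal_induct)
    (auto simp: coeff_sum_add coeff_sum_diff coeff_sum_single)

lemma lookup_initial_form:
  "Poly_Mapping.lookup (initial_form wt p) t =
     (if \<forall>s\<in>Poly_Mapping.keys p. wt s \<le> wt t then Poly_Mapping.lookup p t else 0)"
proof (cases "\<forall>s\<in>Poly_Mapping.keys p. wt s \<le> wt t")
  case True
  then show ?thesis
    unfolding initial_form_def lookup_sum by (auto simp: lookup_single when_def in_keys_iff)
next
  case False
  then show ?thesis
    unfolding initial_form_def lookup_sum by (auto simp: lookup_single when_def intro!: sum.neutral)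
qed

lemma keys_initial_form:
  "Poly_Mapping.keys (initial_form wt p) = {t\<in>Poly_Mapping.keys p. \<forall>s\<in>Poly_Mapping.keys p. wt s \<le> wt t}"
  by (auto simp: in_keys_iff lookup_initial_form split: if_split_asm)

text \<open>The exponents of minimal \<open>w\<close>-weight in the fiber of \<open>z\<close> under the map \<open>t \<mapsto> At\<close> on \<open>\<nat>^n\<close>.\<close>

definition fiber_min :: "int^'n^'d \<Rightarrow> real^'n \<Rightarrow> int^'d \<Rightarrow> (nat^'n) set" where
  "fiber_min A w z = {t. A *v nvec t = z \<and> (\<forall>s. A *v nvec s = z \<longrightarrow> w \<bullet> nvec t \<le> w \<bullet> nvec s)}"

text \<open>If an initial form of an element \<open>g\<close> of the toric ideal has a term of minimal weight in its fiber,
then all terms of \<open>g\<close> in that fiber have this same weight, hence belong to the initial form, and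
their coefficients add up to zero.  The shift by \<open>s\<close> accounts for the multiples of initial forms.\<close>

lemma coeff_sum_initial_form:
  fixes w :: "real^'n::finite" and g :: "('n, 'k::comm_ring_1) pol"
  assumes g: "g \<in> toric_ideal A"
  shows "coeff_sum {t. s + t \<in> fiber_min A w z} (initial_form (\<lambda>t. w \<bullet> nvec t) g) = 0"
proof (cases "\<exists>t\<in>Poly_Mapping.keys (initial_form (\<lambda>t. w \<bullet> nvec t) g). s + t \<in> fiber_min A w z")
  case False
  then show ?thesis by (auto simp: coeff_sum_def intro!: sum.neutral)
next
  case True
  let ?wt = "\<lambda>t. w \<bullet> (nvec t :: real^'n)"
  let ?F = "\<lambda>t. A *v nvec t = z - A *v nvec s"
  obtain t0 where t0: "t0 \<in> Poly_Mapping.keys g" "\<forall>t\<in>Poly_Mapping.keys g. ?wt t \<le> ?wt t0"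
      "s + t0 \<in> fiber_min A w z"
    using True by (auto simp: keys_initial_form)
  have eq: "(\<forall>r\<in>Poly_Mapping.keys g. ?wt r \<le> ?wt t) \<and> s + t \<in> fiber_min A w z \<longleftrightarrow> ?F t"
    if t: "t \<in> Poly_Mapping.keys g" for t
  proof
    assume "?F t"
    then have Ft: "A *v nvec (s + t) = z"
      by (simp add: nvec_add matrix_vector_right_distrib)
    then have "?wt (s + t0) \<le> ?wt (s + t)"
      using t0(3) unfolding fiber_min_def by blast
    then have "?wt t = ?wt t0"
      using t0(2) t by (simp add: nvec_add inner_add_right order_antisym)
    moreover from this have "?wt (s + t) = ?wt (s + t0)"
      by (simp add: nvec_add inner_add_right)
    ultimately show "(\<forall>r\<in>Poly_Mapping.keys g. ?wt r \<le> ?wt t) \<and> s + t \<in> fiber_min A w z"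
      using t0 Ft by (simp add: fiber_min_def)
  qed (auto simp: fiber_min_def nvec_add matrix_vector_right_distrib algebra_simps)
  have "coeff_sum {t. s + t \<in> fiber_min A w z} (initial_form ?wt g) = coeff_sum {t. ?F t} g"
    unfolding coeff_sum_def keys_initial_form lookup_initial_form
    by (rule sum.mono_neutral_cong_left) (use eq in auto)
  then show ?thesis by (simp add: coeff_sum_toric_ideal g)
qed

lemma coeff_sum_initial_ideal:
  fixes A :: "int^'n^'d"
  assumes "p \<in> initial_ideal w (toric_ideal A)"
  shows "coeff_sum (fiber_min A w z) p = (0 :: 'k::comm_ring_1)"
proof -
  interpret M: module "(*) :: ('n, 'k) pol \<Rightarrow> _"
    by (rule module_mult)
  have gen: "coeff_sum (fiber_min A w z) (q * initial_form (\<lambda>t. w \<bullet> nvec t) g) = 0"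
    if "g \<in> toric_ideal A" for q g :: "('n, 'k) pol"
    by (induction q rule: poly_mapping_monomial_induct)
      (simp_all add: distrib_right coeff_sum_add coeff_sum_single_mult coeff_sum_initial_form that)
  show ?thesis
    using assms unfolding initial_ideal_def ideal_of_def
    by (induction p rule: M.span_induct_alt) (use gen in \<open>auto simp: coeff_sum_add\<close>)
qed

text \<open>Tilting \<open>w\<close> slightly in the direction
of \<open>u\<close> makes \<open>\<partial>^(u_+)\<close> the initial form of \<open>\<partial>^(u_+) - \<partial>^(u_-)\<close>; since the initial ideal does not
change, it contains \<open>\<partial>^(u_+)\<close>, and so \<open>u_+\<close> is not of minimal weight in its fiber.\<close>

lemma generic_not_fiber_min:
  fixes A :: "int^'n::finite^'d" and \<beta> :: "'k::field_char_0^'d"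
  assumes gen: "generic_weight A \<beta> w" and u: "u \<in> kernel_lattice A" "u \<noteq> 0" and wu: "w \<bullet> ivec u = 0"
  obtains t where "A *v nvec t = A *v nvec (pos_part u)" "w \<bullet> nvec t < w \<bullet> nvec (pos_part u)"
proof (rule ccontr)
  assume "\<not> thesis"
  then have min: "pos_part u \<in> fiber_min A w (A *v nvec (pos_part u))"
    using that by (force simp: fiber_min_def)
  define ur where "ur = (ivec u :: real^'n)"
  have ur0: "ur \<noteq> 0"
    using u(2) unfolding ur_def by (metis ivec_0 ivec_eq_iff)
  obtain e where e: "e > 0" "\<And>w'. dist w' w < e \<Longrightarrow>
      initial_ideal w' (toric_ideal A :: ('n, 'k) pol set) = initial_ideal w (toric_ideal A)"
    using gen unfolding generic_weight_def eventually_nhds_metric by blast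
  define c where "c = e / (2 * norm ur)"
  define w' where "w' = w + c *\<^sub>R ur"
  have c: "c > 0" using e ur0 by (simp add: c_def)
  have "dist w' w < e"
    using ur0 e by (simp add: w'_def dist_norm c_def)
  then have eq: "initial_ideal w' (toric_ideal A :: ('n, 'k) pol set) = initial_ideal w (toric_ideal A)"
    by (rule e)
  let ?p = "monomial (pos_part u) - monomial (neg_part u) :: ('n, 'k) pol"
  have "w' \<bullet> ur > 0"
    using c ur0 wu by (simp add: w'_def inner_add_left ur_def)
  then have lt: "w' \<bullet> nvec (neg_part u) < w' \<bullet> nvec (pos_part u)"
    unfolding ur_def nvec_pos_minus_neg [symmetric] by (simp add: inner_diff_right)
  then have ne: "pos_part u \<noteq> neg_part u" by auto
  have keys: "Poly_Mapping.keys ?p = {pos_part u, neg_part u}"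
    using ne by (auto simp: in_keys_iff lookup_minus lookup_single when_def split: if_splits)
  have "initial_form (\<lambda>t. w' \<bullet> nvec t) ?p = monomial (pos_part u)"
    using lt ne
    by (intro poly_mapping_eqI) (auto simp: lookup_initial_form keys lookup_minus lookup_single when_def)
  moreover have "?p \<in> toric_ideal A"
    by (rule binomial_in_toric_ideal [OF matrix_nvec_pos_part [OF u(1)]])
  ultimately have "monomial (pos_part u) \<in> initial_form (\<lambda>t. w' \<bullet> nvec t) ` (toric_ideal A :: ('n, 'k) pol set)"
    by (metis imageI)
  moreover have "module ((*) :: ('n, 'k) pol \<Rightarrow> _)"
    by (rule module_mult)
  ultimately have "monomial (pos_part u) \<in> initial_ideal w' (toric_ideal A :: ('n, 'k) pol set)"
    unfolding initial_ideal_def ideal_of_def by (intro module.span_base)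
  then have "coeff_sum (fiber_min A w (A *v nvec (pos_part u))) (monomial (pos_part u)) = (0 :: 'k)"
    unfolding eq by (rule coeff_sum_initial_ideal)
  then show False using min by (simp add: coeff_sum_single)
qed

section \<open>Weights on the kernel lattice along a face\<close>

text \<open>On the kernel of \<open>A\<close> the weight \<open>w\<close> may be replaced by \<open>w - cA\<close>, which for the covector \<open>c\<close> of a
face \<open>I\<close> vanishes on \<open>I\<close> and is positive elsewhere.\<close>

lemma weight_decomp:
  fixes A :: "int^'n::finite^'d::finite" and z :: "int^'n" and c :: "real^'d"
  shows "w \<bullet> ivec z =
    (\<Sum>j\<in>UNIV. (w $ j - c \<bullet> ivec (column j A)) * of_int (z $ j)) + c \<bullet> ivec (A *v z)"
proof -
  have "c \<bullet> ivec (A *v z) = (\<Sum>i\<in>UNIV. \<Sum>j\<in>UNIV. c $ i * (of_int (A $ i $ j) * of_int (z $ j)))"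
    by (simp add: inner_vec_def matrix_vector_mult_def sum_distrib_left)
  also have "\<dots> = (\<Sum>j\<in>UNIV. (c \<bullet> ivec (column j A)) * of_int (z $ j))"
    by (subst sum.swap) (simp add: inner_vec_def column_def sum_distrib_right mult.assoc)
  finally show ?thesis
    by (simp add: inner_vec_def left_diff_distrib sum_subtractf)
qed

text \<open>The empty face has a covector as well: the multiple of the linear form from the hyperplane that takes
a sufficiently negative constant value on the columns.\<close>

lemma regular_face_covector:
  fixes A :: "int^'n::finite^'d::finite"
  assumes "on_hyperplane_off_origin A" "I \<in> regular_faces A w"
  obtains c :: "real^'d" where "\<And>j. j \<in> I \<Longrightarrow> c \<bullet> ivec (column j A) = w $ j"
    "\<And>j. j \<notin> I \<Longrightarrow> c \<bullet> ivec (column j A) < w $ j"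
proof (cases "I = {}")
  case True
  obtain h c where hc: "c \<noteq> 0" "\<And>j. (\<Sum>i\<in>UNIV. h $ i * of_int (A $ i $ j)) = (c::rat)"
    using assms(1) by (auto simp: on_hyperplane_off_origin_def)
  define M where "M = (\<Sum>j\<in>UNIV. \<bar>w $ j\<bar>) + 1"
  define c' :: "real^'d" where "c' = (- M / of_rat c) *\<^sub>R qvec h"
  have "c' \<bullet> ivec (column j A) < w $ j" for j
  proof -
    have "qvec h \<bullet> ivec (column j A) = of_rat (\<Sum>i\<in>UNIV. h $ i * of_int (A $ i $ j))"
      by (simp add: inner_vec_def qvec_def column_def of_rat_sum of_rat_mult)
    then have "c' \<bullet> ivec (column j A) = - M"
      using hc by (simp add: c'_def)
    moreover have "\<bar>w $ j\<bar> \<le> (\<Sum>j\<in>UNIV. \<bar>w $ j\<bar>)"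
      by (rule member_le_sum) auto
    ultimately show ?thesis by (simp add: M_def)
  qed
  then show ?thesis using True that by blast
next
  case False
  then show ?thesis using assms(2) that by (auto simp: regular_faces_def)
qed

text \<open>The columns indexed by a face are linearly independent over the integers: a relation would have
weight zero, but its positive part is supported on \<open>I\<close> and thus already of least weight in its fiber.\<close>

lemma regular_face_independent:
  fixes A :: "int^'n::finite^'d::finite" and \<beta> :: "'k::field_char_0^'d" and c :: "real^'d"
  assumes gen: "generic_weight A \<beta> w"
    and c: "\<And>j. j \<in> I \<Longrightarrow> c \<bullet> ivec (column j A) = w $ j"
      "\<And>j. j \<notin> I \<Longrightarrow> c \<bullet> ivec (column j A) < w $ j"
    and u: "u \<in> kernel_lattice A" "\<And>j. j \<notin> I \<Longrightarrow> u $ j = 0"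
  shows "u = 0"
proof (rule ccontr)
  assume "u \<noteq> 0"
  have *: "w \<bullet> nvec t = (\<Sum>j\<in>UNIV. (w $ j - c \<bullet> ivec (column j A)) * of_nat (t $ j)) + c \<bullet> ivec (A *v nvec t)" for t
    using weight_decomp [of w "nvec t" c A] by simp
  have "(w $ j - c \<bullet> ivec (column j A)) * of_int (u $ j) = 0" for j
    using u(2) [of j] c(1) [of j] by (cases "j \<in> I") auto
  then have "(\<Sum>j\<in>UNIV. (w $ j - c \<bullet> ivec (column j A)) * of_int (u $ j)) = 0"
    by (intro sum.neutral ballI)
  then have "w \<bullet> ivec u = 0"
    unfolding weight_decomp [of w u c A] using u(1) by (simp add: kernel_lattice_def)
  with gen u(1) \<open>u \<noteq> 0\<close> obtain t where
    t: "A *v nvec t = A *v nvec (pos_part u)" "w \<bullet> nvec t < w \<bullet> nvec (pos_part u)"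
    by (rule generic_not_fiber_min)
  have "(w $ j - c \<bullet> ivec (column j A)) * real (pos_part u $ j) = 0" for j
    using u(2) [of j] c(1) [of j] by (cases "j \<in> I") (auto simp: pos_part_def)
  then have "(\<Sum>j\<in>UNIV. (w $ j - c \<bullet> ivec (column j A)) * real (pos_part u $ j)) = 0"
    by (intro sum.neutral ballI)
  moreover have "(\<Sum>j\<in>UNIV. (w $ j - c \<bullet> ivec (column j A)) * real (t $ j)) \<ge> 0"
  proof (intro sum_nonneg mult_nonneg_nonneg)
    show "0 \<le> w $ j - c \<bullet> ivec (column j A)" for j
      using c [of j] by (cases "j \<in> I") auto
  qed auto
  ultimately show False
    using t * [of t] * [of "pos_part u"] by simp
qed

lemma clear_denominators:
  fixes x :: "rat^'n::finite"
  obtains N :: int and u :: "int^'n" where "N > 0" "of_int N *s x = ivec u"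
proof -
  have "\<forall>j. \<exists>a b. b > 0 \<and> x $ j = of_int a / of_int b"
    by (metis quotient_of_denom_pos' quotient_of_div surjective_pairing)
  then obtain a b where ab: "\<And>j. b j > (0::int)" "\<And>j. x $ j = of_int (a j) / of_int (b j)"
    by metis
  define N where "N = prod b UNIV"
  define u :: "int^'n" where "u = (\<chi> j. a j * prod b (UNIV - {j}))"
  have "of_int N * x $ j = of_int (u $ j)" for j
  proof -
    have "N = b j * prod b (UNIV - {j})"
      unfolding N_def by (rule prod.remove) auto
    then show ?thesis
      using ab(1) [of j] by (simp add: u_def ab(2))
  qed
  then show ?thesis
    by (intro that [of N u]) (auto simp: N_def ab(1) prod_pos vec_eq_iff)
qed

lemma kernel_bound:
  fixes A :: "int^'n::finite^'d::finite"
  assumes ind: "\<And>u. u \<in> kernel_lattice A \<Longrightarrow> (\<And>j. j \<notin> I \<Longrightarrow> u $ j = 0) \<Longrightarrow> u = 0"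
  obtains C :: real where "C > 0"
    "\<And>u. u \<in> kernel_lattice A \<Longrightarrow> (\<Sum>j\<in>UNIV. \<bar>of_int (u $ j)\<bar>) \<le> C * (\<Sum>j\<in>-I. \<bar>of_int (u $ j)\<bar>)"
proof -
  \<comment> \<open>The rational map \<open>x \<mapsto> (Ax, x restricted to the complement of I)\<close> is injective; a left inverse \<open>B\<close>
    expresses all coordinates of a kernel vector through those outside \<open>I\<close>.\<close>
  define M :: "rat^'n^('d + 'n)" where
    "M = (\<chi> k. case k of Inl i \<Rightarrow> imat A $ i | Inr j \<Rightarrow> if j \<in> I then 0 else axis j 1)"
  have M1: "(M *v x) $ Inl i = (imat A *v x) $ i" for x i
    by (simp add: M_def matrix_vector_mult_def)
  have M2: "(M *v x) $ Inr j = (if j \<in> I then 0 else x $ j)" for x j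
    by (simp add: M_def matrix_vector_mult_def axis_def if_distrib [of "\<lambda>t. t * _"] cong: if_cong)
  have "x = 0" if x: "M *v x = 0" for x
  proof -
    obtain N u where N: "N > 0" "of_int N *s x = ivec u"
      by (rule clear_denominators)
    have "imat A *v x = 0"
      using M1 [of x] x by (simp add: vec_eq_iff)
    then have "imat A *v (of_int N *s x) = 0"
      by (simp add: vec.scale)
    then have "(ivec (A *v u) :: rat^'d) = ivec 0"
      unfolding N(2) imat_ivec by simp
    then have "u \<in> kernel_lattice A"
      unfolding ivec_eq_iff kernel_lattice_def by simp
    moreover have "u $ j = 0" if "j \<notin> I" for j
    proof -
      have "x $ j = 0" using M2 [of x j] x that by simp
      then have "(of_int N *s x) $ j = 0" by simp
      then show ?thesis unfolding N(2) by simp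
    qed
    ultimately have "u = 0" by (rule ind)
    then show ?thesis using N by (simp add: vec_eq_iff)
  qed
  then have "\<exists>B. B ** M = mat 1"
    by (intro matrix_left_invertible_ker [THEN iffD2]) simp
  then obtain B where B: "B ** M = mat 1" ..
  define b where "b = (\<Sum>i\<in>UNIV. \<Sum>j\<in>UNIV. \<bar>real_of_rat (B $ i $ Inr j)\<bar>)"
  have "(\<Sum>j\<in>UNIV. \<bar>of_int (u $ j)\<bar>) \<le> (b + 1) * (\<Sum>j\<in>-I. \<bar>of_int (u $ j) :: real\<bar>)"
    if u: "u \<in> kernel_lattice A" for u
  proof -
    have eq: "real_of_int (u $ i) = (\<Sum>j\<in>-I. of_rat (B $ i $ Inr j) * of_int (u $ j))" for i
    proof -
      have "B *v (M *v ivec u) = ivec u"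
        by (simp add: matrix_vector_mul_assoc B)
      then have "(B *v (M *v ivec u)) $ i = of_int (u $ i)"
        by simp
      then have "of_int (u $ i) = (\<Sum>k\<in>UNIV. B $ i $ k * (M *v ivec u) $ k)"
        by (simp add: matrix_vector_mult_def [of B])
      also have "\<dots> = (\<Sum>j\<in>UNIV. B $ i $ Inr j * (if j \<in> I then 0 else of_int (u $ j)))"
        using u by (simp add: UNIV_Plus_UNIV [symmetric] sum.Plus M1 M2 imat_ivec kernel_lattice_def
            del: UNIV_Plus_UNIV cong: if_cong)
      also have "\<dots> = (\<Sum>j\<in>-I. B $ i $ Inr j * of_int (u $ j))"
        by (intro sum.mono_neutral_cong_right) auto
      finally have "real_of_rat (of_int (u $ i)) = of_rat (\<Sum>j\<in>-I. B $ i $ Inr j * of_int (u $ j))"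
        by simp
      then show ?thesis by (simp add: of_rat_sum of_rat_mult)
    qed
    let ?s = "\<Sum>j\<in>-I. \<bar>of_int (u $ j) :: real\<bar>"
    have "\<bar>of_int (u $ i)\<bar> \<le> (\<Sum>j\<in>UNIV. \<bar>real_of_rat (B $ i $ Inr j)\<bar>) * ?s" for i
    proof -
      have "\<bar>of_int (u $ i)\<bar> \<le> (\<Sum>j\<in>-I. \<bar>real_of_rat (B $ i $ Inr j)\<bar> * \<bar>of_int (u $ j)\<bar>)"
        unfolding eq [of i] abs_mult [symmetric] by (rule sum_abs)
      also have "\<dots> \<le> (\<Sum>j\<in>-I. \<bar>real_of_rat (B $ i $ Inr j)\<bar> * ?s)"
        by (intro sum_mono mult_left_mono) (auto intro: member_le_sum [where f = "\<lambda>j. \<bar>of_int (u $ j)\<bar>"])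
      also have "\<dots> \<le> (\<Sum>j\<in>UNIV. \<bar>real_of_rat (B $ i $ Inr j)\<bar> * ?s)"
        by (intro sum_mono2) (auto intro!: mult_nonneg_nonneg sum_nonneg)
      finally show ?thesis by (simp add: sum_distrib_right)
    qed
    then have "(\<Sum>j\<in>UNIV. \<bar>of_int (u $ j)\<bar>) \<le> b * ?s"
      unfolding b_def sum_distrib_right [of _ _ ?s] by (intro sum_mono)
    also have "\<dots> \<le> (b + 1) * ?s"
      by (intro mult_right_mono) (auto intro: sum_nonneg)
    finally show ?thesis .
  qed
  moreover have "b + 1 > 0"
    unfolding b_def by (intro add_nonneg_pos sum_nonneg) auto
  ultimately show ?thesis using that by blast
qed

text \<open>On the kernel vectors whose coordinates outside \<open>I\<close> are bounded below, the weight grows at least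
linearly in the \<open>\<ell>^1\<close>-norm.\<close>

lemma weight_bound:
  fixes A :: "int^'n::finite^'d::finite" and c :: "real^'d" and t :: "'n \<Rightarrow> int"
  assumes ind: "\<And>u. u \<in> kernel_lattice A \<Longrightarrow> (\<And>j. j \<notin> I \<Longrightarrow> u $ j = 0) \<Longrightarrow> u = 0"
    and c: "\<And>j. j \<in> I \<Longrightarrow> c \<bullet> ivec (column j A) = w $ j"
      "\<And>j. j \<notin> I \<Longrightarrow> c \<bullet> ivec (column j A) < w $ j"
  shows "\<exists>e>0. \<exists>M. \<forall>u\<in>kernel_lattice A. (\<forall>j. j \<notin> I \<longrightarrow> - t j \<le> u $ j) \<longrightarrow>
      e * (\<Sum>j\<in>UNIV. \<bar>of_int (u $ j)\<bar>) - M \<le> w \<bullet> ivec u"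
proof -
  obtain C :: real where C: "C > 0"
    "\<And>u. u \<in> kernel_lattice A \<Longrightarrow> (\<Sum>j\<in>UNIV. \<bar>of_int (u $ j)\<bar>) \<le> C * (\<Sum>j\<in>-I. \<bar>of_int (u $ j)\<bar>)"
    using kernel_bound [OF ind] by metis
  define d where "d j = w $ j - c \<bullet> ivec (column j A)" for j
  have d: "d j = 0" if "j \<in> I" for j using c(1) that by (simp add: d_def)
  have d': "d j > 0" if "j \<notin> I" for j using c(2) that by (simp add: d_def)
  define m where "m = Min (insert 1 (d ` (- I)))"
  have m: "m > 0" "\<And>j. j \<notin> I \<Longrightarrow> m \<le> d j"
    using d' by (auto simp: m_def)
  define M where "M = (\<Sum>j\<in>-I. 2 * d j * \<bar>of_int (t j)\<bar>)"
  show ?thesis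
  proof (rule exI [of _ "m / C"], intro conjI exI [of _ M] ballI impI)
    show "m / C > 0" using m C by simp
    fix u assume u: "u \<in> kernel_lattice A" "\<forall>j. j \<notin> I \<longrightarrow> - t j \<le> u $ j"
    have "m / C * (\<Sum>j\<in>UNIV. \<bar>of_int (u $ j)\<bar>) \<le> m / C * (C * (\<Sum>j\<in>-I. \<bar>of_int (u $ j)\<bar>))"
      using m C u by (intro mult_left_mono) auto
    also have "\<dots> = (\<Sum>j\<in>-I. m * \<bar>of_int (u $ j)\<bar>)"
      using C by (simp add: sum_distrib_left)
    also have "\<dots> \<le> (\<Sum>j\<in>-I. d j * of_int (u $ j) + 2 * d j * \<bar>of_int (t j)\<bar>)"
    proof (rule sum_mono)
      fix j assume j: "j \<in> - I"
      have "m * \<bar>of_int (u $ j)\<bar> \<le> d j * \<bar>of_int (u $ j)\<bar>"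
        using m j by (intro mult_right_mono) auto
      also have "\<dots> \<le> d j * (of_int (u $ j) + 2 * \<bar>of_int (t j)\<bar>)"
        using d' [of j] u(2) j by (intro mult_left_mono) auto
      finally show "m * \<bar>of_int (u $ j)\<bar> \<le> d j * of_int (u $ j) + 2 * d j * \<bar>of_int (t j)\<bar>"
        by (simp add: algebra_simps)
    qed
    also have "\<dots> = (\<Sum>j\<in>-I. d j * of_int (u $ j)) + M"
      by (simp add: sum.distrib M_def)
    also have "(\<Sum>j\<in>-I. d j * of_int (u $ j)) = (\<Sum>j\<in>UNIV. d j * of_int (u $ j))"
      by (intro sum.mono_neutral_left) (auto simp: d)
    also have "\<dots> = w \<bullet> ivec u"
      using u(1) unfolding weight_decomp [of w u c A] by (simp add: d_def kernel_lattice_def)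
    finally show "m / C * (\<Sum>j\<in>UNIV. \<bar>of_int (u $ j)\<bar>) - M \<le> w \<bullet> ivec u" by simp
  qed
qed

lemma finite_bounded_int_vec: "finite {u :: int^'n::finite. (\<Sum>j\<in>UNIV. \<bar>of_int (u $ j)\<bar>) \<le> (R :: real)}"
proof (rule finite_subset)
  show "{u :: int^'n. (\<Sum>j\<in>UNIV. \<bar>of_int (u $ j)\<bar>) \<le> R} \<subseteq> vec_lambda ` (PiE UNIV (\<lambda>_. {-\<lceil>R\<rceil>..\<lceil>R\<rceil>}))"
  proof
    fix u :: "int^'n" assume u: "u \<in> {u. (\<Sum>j\<in>UNIV. \<bar>of_int (u $ j)\<bar>) \<le> R}"
    have "u $ j \<in> {-\<lceil>R\<rceil>..\<lceil>R\<rceil>}" for j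
    proof -
      have "\<bar>of_int (u $ j)\<bar> \<le> (\<Sum>j\<in>UNIV. \<bar>of_int (u $ j) :: real\<bar>)"
        by (rule member_le_sum) auto
      then have "\<bar>of_int (u $ j)\<bar> \<le> R" using u by simp
      then have "\<bar>u $ j\<bar> \<le> \<lceil>R\<rceil>" by linarith
      then show ?thesis by auto
    qed
    then show "u \<in> vec_lambda ` (PiE UNIV (\<lambda>_. {-\<lceil>R\<rceil>..\<lceil>R\<rceil>}))"
      by (intro image_eqI [of _ _ "($) u"]) (auto simp: vec_lambda_eta)
  qed
qed (intro finite_imageI finite_PiE, auto)

text \<open>The closed cone \<open>w \<bullet> q \<ge> e |q|_1\<close> around \<open>w\<close> lies in a simplicial rational cone on which \<open>w\<close> is still
positive.  The facets of the simplicial cone are cut out by the linear forms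
\<open>f_j = r + \<delta> s_j e_j\<close>, where \<open>s_j\<close> is the sign of \<open>w_j\<close> and the rational vector \<open>r\<close> approximates \<open>w\<close>
from inside.  All \<open>f_j\<close> are so close to \<open>w\<close> that they are nonnegative on the cone around \<open>w\<close>,
and \<open>w\<close> is a combination of them with positive coefficients; these coefficients are the weights of the
dual basis \<open>b_j\<close>, which generates the simplicial cone.\<close>

lemma rational_cone_basis:
  fixes w :: "real^'n::finite"
  assumes "w \<noteq> 0" "e > 0"
  obtains B :: "(rat^'n) set" where "vec.independent B" "vec.span B = UNIV"
    "\<And>b. b \<in> B \<Longrightarrow> w \<bullet> qvec b > 0"
    "\<And>q. w \<bullet> qvec q \<ge> e * (\<Sum>j\<in>UNIV. \<bar>of_rat (q $ j)\<bar>) \<Longrightarrow> q \<in> rat_cone B"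
proof -
  define s :: "'n \<Rightarrow> rat" where "s j = (if w $ j < 0 then -1 else 1)" for j
  have ss: "s j * s j = 1" for j by (simp add: s_def)
  have sw: "of_rat (s j) * w $ j = \<bar>w $ j\<bar>" for j by (simp add: s_def)
  define S where "S = (\<Sum>j\<in>UNIV. \<bar>w $ j\<bar>)"
  have S: "S > 0"
  proof -
    obtain j where "w $ j \<noteq> 0" using assms(1) by (auto simp: vec_eq_iff)
    then show ?thesis unfolding S_def by (intro sum_pos2 [of _ j]) auto
  qed
  obtain \<delta> :: rat where \<delta>: "0 < real_of_rat \<delta>" "real_of_rat \<delta> < e / 2"
    using of_rat_dense [of 0 "e / 2"] assms(2) by auto
  define m where "m = real_of_rat \<delta> / CARD('n)"
  have m: "m > 0" using \<delta> by (simp add: m_def)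
  have "\<exists>\<rho>. \<bar>w $ j\<bar> - m < real_of_rat \<rho> \<and> real_of_rat \<rho> < \<bar>w $ j\<bar>" for j
    using of_rat_dense [of "\<bar>w $ j\<bar> - m" "\<bar>w $ j\<bar>"] m by auto
  then obtain \<rho> :: "'n \<Rightarrow> rat" where \<rho>: "\<And>j. \<bar>w $ j\<bar> - m < of_rat (\<rho> j)" "\<And>j. of_rat (\<rho> j) < \<bar>w $ j\<bar>"
    by metis
  define r where "r j = s j * \<rho> j" for j
  have sr: "s j * r j = \<rho> j" for j by (simp add: r_def ss mult.assoc [symmetric])
  define R where "R = (\<Sum>j\<in>UNIV. \<rho> j)"
  have RS: "real_of_rat R < S"
    unfolding R_def S_def of_rat_sum by (intro sum_strict_mono) (auto simp: \<rho>)
  have "S - real_of_rat R = (\<Sum>j\<in>UNIV. \<bar>w $ j\<bar> - of_rat (\<rho> j))"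
    by (simp add: R_def S_def of_rat_sum sum_subtractf)
  also have "\<dots> < (\<Sum>j\<in>(UNIV::'n set). m)"
  proof (rule sum_strict_mono)
    show "\<bar>w $ j\<bar> - of_rat (\<rho> j) < m" for j using \<rho>(1) [of j] by linarith
  qed auto
  finally have RS': "S < real_of_rat (\<delta> + R)" by (simp add: m_def of_rat_add)
  have dR: "\<delta> + R > 0"
  proof -
    have "real_of_rat (\<delta> + R) > 0" using RS' S by linarith
    then show ?thesis by simp
  qed
  have d0: "\<delta> > 0" using \<delta>(1) by simp
  \<comment> \<open>The basis dual to the forms \<open>f j\<close>, computed by inverting a rank-one perturbation of a diagonal
    matrix.\<close>
  define b :: "'n \<Rightarrow> rat^'n" where
    "b i = (\<chi> j. s j * ((if i = j then 1 else 0) - \<rho> i / (\<delta> + R)) / \<delta>)" for i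
  define f where "f j q = (\<Sum>i\<in>UNIV. r i * q $ i) + \<delta> * s j * q $ j" for j and q :: "rat^'n"
  have expand: "q = (\<Sum>i\<in>UNIV. f i q *s b i)" for q
  proof (rule vec_eq_iff [THEN iffD2], intro allI)
    fix j
    let ?t = "\<Sum>i\<in>UNIV. r i * q $ i"
    have "(\<Sum>i\<in>UNIV. \<rho> i * f i q) = R * ?t + (\<Sum>i\<in>UNIV. \<delta> * (s i * \<rho> i) * q $ i)"
      unfolding f_def distrib_left sum.distrib R_def sum_distrib_right by (simp add: mult_ac)
    also have "(\<Sum>i\<in>UNIV. \<delta> * (s i * \<rho> i) * q $ i) = \<delta> * ?t"
      by (simp add: r_def sum_distrib_left mult.assoc)
    finally have 1: "(\<Sum>i\<in>UNIV. \<rho> i * f i q) = (\<delta> + R) * ?t" by (simp add: algebra_simps)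
    have "(\<Sum>i\<in>UNIV. f i q *s b i) $ j =
        (\<Sum>i\<in>UNIV. (s j / \<delta>) * ((if i = j then f i q else 0) - \<rho> i * f i q / (\<delta> + R)))"
      unfolding sum_component by (rule sum.cong) (auto simp: b_def divide_simps algebra_simps)
    also have "\<dots> = (s j / \<delta>) * (f j q - (\<Sum>i\<in>UNIV. \<rho> i * f i q) / (\<delta> + R))"
      unfolding sum_distrib_left [symmetric] sum_subtractf sum_divide_distrib [symmetric] by simp
    also have "\<dots> = (s j / \<delta>) * (\<delta> * s j * q $ j)"
      using dR unfolding 1 by (simp add: f_def)
    also have "\<dots> = q $ j" using d0 ss [of j] by (simp add: field_simps)
    finally show "q $ j = (\<Sum>i\<in>UNIV. f i q *s b i) $ j" by simp
  qed
  have span: "vec.span (range b) = UNIV"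
  proof -
    have "q \<in> vec.span (range b)" for q
      by (subst expand) (intro vec.span_sum vec.span_scale vec.span_base, auto)
    then show ?thesis by auto
  qed
  have card: "card (range b) = CARD('n)"
  proof (rule antisym)
    show "card (range b) \<le> CARD('n)" by (rule card_image_le) simp
    have "CARD('n) = vec.dim (range b)"
      using span by (metis vec.dim_span vec_dim_card)
    also have "\<dots> \<le> card (range b)"
      by (rule vec.dim_le_card [OF vec.span_superset]) simp
    finally show "CARD('n) \<le> card (range b)" .
  qed
  then have inj: "inj b" by (simp add: eq_card_imp_inj_on)
  have ind: "vec.independent (range b)"
    by (rule vec.card_le_dim_spanning [of _ UNIV]) (simp_all add: span card vec_dim_card del: vec.dim_UNIV)
  have pos: "w \<bullet> qvec (b i) > 0" for i
  proof -
    have "w \<bullet> qvec (b i) = (\<Sum>j\<in>UNIV. (of_rat (s j) * w $ j) *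
        ((if i = j then 1 else 0) - of_rat (\<rho> i / (\<delta> + R))) / of_rat \<delta>)"
      unfolding inner_vec_def
      by (rule sum.cong) (auto simp: qvec_def b_def of_rat_mult of_rat_divide of_rat_diff)
    also have "\<dots> = (\<Sum>j\<in>UNIV. ((if i = j then \<bar>w $ j\<bar> else 0) - \<bar>w $ j\<bar> * of_rat (\<rho> i / (\<delta> + R))) / of_rat \<delta>)"
      unfolding sw by (rule sum.cong) (auto simp: algebra_simps)
    also have "\<dots> = (\<bar>w $ i\<bar> - S * of_rat (\<rho> i / (\<delta> + R))) / of_rat \<delta>"
      unfolding sum_divide_distrib [symmetric] sum_subtractf S_def sum_distrib_right by simp
    also have "\<dots> > 0"
    proof (rule divide_pos_pos)
      have "S * of_rat (\<rho> i) < of_rat (\<delta> + R) * \<bar>w $ i\<bar>"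
      proof (cases "\<rho> i \<ge> 0")
        case True
        have "S * of_rat (\<rho> i) < S * \<bar>w $ i\<bar>" using \<rho>(2) S by simp
        also have "\<dots> \<le> of_rat (\<delta> + R) * \<bar>w $ i\<bar>" using RS' by (intro mult_right_mono) auto
        finally show ?thesis .
      next
        case False
        then have "S * of_rat (\<rho> i) < 0" using S by (simp add: mult_pos_neg)
        also have "\<dots> \<le> of_rat (\<delta> + R) * \<bar>w $ i\<bar>" using dR by (intro mult_nonneg_nonneg) auto
        finally show ?thesis .
      qed
      then show "0 < \<bar>w $ i\<bar> - S * of_rat (\<rho> i / (\<delta> + R))"
        using dR by (simp add: of_rat_divide field_simps del: of_rat_add)
    qed (use \<delta> in simp)
    finally show ?thesis .
  qed
  have cone: "q \<in> rat_cone (range b)" if q: "w \<bullet> qvec q \<ge> e * (\<Sum>j\<in>UNIV. \<bar>of_rat (q $ j)\<bar>)" for q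
  proof -
    have "f i q \<ge> 0" for i
    proof -
      have "real_of_rat (f i q) = (\<Sum>j\<in>UNIV. (of_rat (r j) + (if j = i then of_rat (\<delta> * s i) else 0)) * of_rat (q $ j))"
        by (simp add: f_def of_rat_add of_rat_mult of_rat_sum distrib_right sum.distrib
            if_distrib [of "\<lambda>t. t * _"] cong: if_cong)
      also have "\<dots> = w \<bullet> qvec q -
          (\<Sum>j\<in>UNIV. (w $ j - of_rat (r j) - (if j = i then of_rat (\<delta> * s i) else 0)) * of_rat (q $ j))"
        unfolding inner_vec_def qvec_def by (simp add: sum_subtractf [symmetric] algebra_simps)
      finally have 1: "real_of_rat (f i q) = w \<bullet> qvec q -
          (\<Sum>j\<in>UNIV. (w $ j - of_rat (r j) - (if j = i then of_rat (\<delta> * s i) else 0)) * of_rat (q $ j))" .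
      have "(\<Sum>j\<in>UNIV. (w $ j - of_rat (r j) - (if j = i then of_rat (\<delta> * s i) else 0)) * of_rat (q $ j))
          \<le> (\<Sum>j\<in>UNIV. e * \<bar>of_rat (q $ j)\<bar>)"
      proof (rule sum_mono)
        fix j
        have "\<bar>w $ j - of_rat (r j)\<bar> = \<bar>of_rat (s j) * (of_rat (s j) * w $ j - of_rat (s j * r j))\<bar>"
          by (simp add: s_def of_rat_mult)
        also have "\<dots> = \<bar>\<bar>w $ j\<bar> - of_rat (\<rho> j)\<bar>"
          unfolding sw sr by (simp add: s_def abs_mult)
        also have "\<dots> \<le> m" using \<rho> [of j] by simp
        also have "m \<le> of_rat \<delta>" using \<delta>(1) by (simp add: m_def divide_le_eq)
        finally have 2: "\<bar>w $ j - of_rat (r j)\<bar> \<le> of_rat \<delta>" .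
        have 3: "\<bar>if j = i then of_rat (\<delta> * s i) else 0 :: real\<bar> \<le> of_rat \<delta>"
          using d0 by (auto simp: s_def of_rat_minus)
        let ?x = "w $ j - of_rat (r j) - (if j = i then of_rat (\<delta> * s i) else 0)"
        have "\<bar>?x\<bar> \<le> e" using 2 3 \<delta>(2) by linarith
        have "?x * of_rat (q $ j) \<le> \<bar>?x\<bar> * \<bar>of_rat (q $ j)\<bar>"
          unfolding abs_mult [symmetric] by (rule abs_ge_self)
        also have "\<dots> \<le> e * \<bar>of_rat (q $ j)\<bar>" using \<open>\<bar>?x\<bar> \<le> e\<close> by (intro mult_right_mono) auto
        finally show "?x * of_rat (q $ j) \<le> e * \<bar>of_rat (q $ j)\<bar>" .
      qed
      also have "\<dots> \<le> w \<bullet> qvec q" using q by (simp add: sum_distrib_left)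
      finally have "real_of_rat (f i q) \<ge> 0" using 1 by simp
      then show ?thesis by simp
    qed
    moreover have "q = (\<Sum>x\<in>range b. f (inv b x) q *s x)"
      using expand [of q] by (simp add: sum.reindex [OF inj] inj)
    ultimately show ?thesis
      unfolding rat_cone_def by (intro CollectI exI [of _ "\<lambda>x. f (inv b x) q"] conjI ballI)
  qed
  show ?thesis
    by (rule that [of "range b"]) (use ind span pos cone in auto)
qed

section \<open>Falling factorials and the Leibniz rule\<close>

text \<open>The falling factorial \<open>x (x - 1) \<cdots> (x - n + 1)\<close>, so that \<open>[v]_t\<close> is a product of these.\<close>

definition ffact :: "'k::comm_ring_1 \<Rightarrow> nat \<Rightarrow> 'k" where
  "ffact x n = (\<Prod>m<n. x - of_nat m)"

lemma falling_ffact: "falling v t = (\<Prod>j\<in>UNIV. ffact (v $ j) (t $ j))"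
  by (simp add: falling_def ffact_def)

lemma ffact_0 [simp]: "ffact x 0 = 1"
  by (simp add: ffact_def)

lemma ffact_add: "ffact x (m + n) = ffact x m * ffact (x - of_nat m) n"
  by (induction n) (simp_all add: ffact_def algebra_simps)

lemma ffact_eq_0:
  assumes "0 \<le> m" "m < int n"
  shows "ffact (of_int m) n = 0"
  unfolding ffact_def by (rule prod_zero) (use assms in \<open>auto intro!: bexI [of _ "nat m"]\<close>)

lemma ffact_gbinomial: "ffact x n = fact n * ((x :: 'k::field_char_0) gchoose n)"
  by (simp add: ffact_def gbinomial_prod_rev atLeast0LessThan)

lemma ffact_of_nat: "(ffact (of_nat c) k :: 'k::field_char_0) = of_nat (fact k * (c choose k))"
  by (simp add: ffact_gbinomial binomial_gbinomial)

lemma ffact_Vandermonde: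
  "ffact (x + y) n = (\<Sum>k\<le>n. of_nat (n choose k) * ffact x k * ffact (y :: 'k::field_char_0) (n - k))"
proof -
  have "ffact (x + y) n = (\<Sum>k\<le>n. fact n * ((x gchoose k) * (y gchoose (n - k))))"
    by (simp add: ffact_gbinomial gbinomial_Vandermonde [symmetric] sum_distrib_left atLeast0AtMost)
  also have "\<dots> = (\<Sum>k\<le>n. of_nat (n choose k) * ffact x k * ffact y (n - k))"
    by (rule sum.cong) (simp_all add: ffact_gbinomial binomial_fact)
  finally show ?thesis .
qed

lemma ffact_Leibniz:
  "(\<Sum>k\<in>{..min b c}. of_nat (fact k * (b choose k) * (c choose k)) * ffact (x - of_nat c) (b - k)) =
    ffact (x :: 'k::field_char_0) b"
proof -
  have "ffact x b = ffact (of_nat c + (x - of_nat c)) b" by simp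
  also have "\<dots> = (\<Sum>k\<le>b. of_nat (b choose k) * ffact (of_nat c) k * ffact (x - of_nat c) (b - k))"
    by (rule ffact_Vandermonde)
  also have "\<dots> = (\<Sum>k\<in>{..min b c}. of_nat (fact k * (b choose k) * (c choose k)) * ffact (x - of_nat c) (b - k))"
    by (rule sum.mono_neutral_cong_right) (auto simp: ffact_of_nat mult_ac)
  finally show ?thesis by simp
qed

lemma falling_add: "falling v (s + t) = falling v s * falling (v - nvec s) t"
  by (simp add: falling_ffact ffact_add prod.distrib)

text \<open>Chu--Vandermonde in several variables.  It expresses that the Leibniz expansion of \<open>\<partial>^b x^c\<close> acts
on the monomial \<open>x^(\<delta> - c)\<close> as \<open>\<partial>^b\<close> acts on \<open>x^\<delta>\<close>.\<close>

lemma falling_Leibniz: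
  fixes \<delta> :: "'k::field_char_0^'n::finite"
  shows "(\<Sum>k | k \<le> b \<and> k \<le> c.
      of_nat (\<Prod>i\<in>UNIV. fact (k $ i) * (b $ i choose k $ i) * (c $ i choose k $ i)) *
      falling (\<delta> - nvec c) (b - k)) = falling \<delta> b"
proof -
  have "falling \<delta> b = (\<Prod>i\<in>UNIV. \<Sum>k\<in>{..min (b $ i) (c $ i)}.
      of_nat (fact k * (b $ i choose k) * (c $ i choose k)) * ffact (\<delta> $ i - of_nat (c $ i)) (b $ i - k))"
    unfolding falling_ffact ffact_Leibniz ..
  also have "\<dots> = (\<Sum>k\<in>PiE UNIV (\<lambda>i. {..min (b $ i) (c $ i)}). \<Prod>i\<in>UNIV.
      of_nat (fact (k i) * (b $ i choose k i) * (c $ i choose k i)) * ffact (\<delta> $ i - of_nat (c $ i)) (b $ i - k i))"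
    by (rule prod_sum_PiE) auto
  also have "\<dots> = (\<Sum>k | k \<le> b \<and> k \<le> c.
      of_nat (\<Prod>i\<in>UNIV. fact (k $ i) * (b $ i choose k $ i) * (c $ i choose k $ i)) *
      falling (\<delta> - nvec c) (b - k))"
    by (rule sum.reindex_bij_witness [of _ "($)" vec_lambda])
      (auto simp: vec_lambda_eta less_eq_vec_def PiE_iff falling_ffact prod.distrib)
  finally show ?thesis by simp
qed

section \<open>The Weyl algebra acting on logarithm-free series\<close>

text \<open>A logarithm-free series is given by its coefficient function \<open>f\<close> on exponents.  The operator
\<open>x^a \<partial>^b\<close> sends \<open>x^\<delta>\<close> to \<open>[\<delta>]_b x^(\<delta> - b + a)\<close>.\<close>

definition coeff_apply ::
    "('n::finite, 'k::comm_ring_1) weyl \<Rightarrow> ('k^'n \<Rightarrow> 'k) \<Rightarrow> 'k^'n \<Rightarrow> 'k" where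
  "coeff_apply P f = (\<lambda>\<gamma>. \<Sum>(a, b)\<in>Poly_Mapping.keys P. Poly_Mapping.lookup P (a, b) *
     (falling (\<gamma> - nvec a + nvec b) b * f (\<gamma> - nvec a + nvec b)))"

lemma coeff_apply_single:
  "coeff_apply (Poly_Mapping.single (a, b) c) f \<gamma> =
    c * (falling (\<gamma> - nvec a + nvec b) b * f (\<gamma> - nvec a + nvec b))"
  by (simp add: coeff_apply_def)

lemma coeff_apply_add: "coeff_apply (P + Q) f \<gamma> = coeff_apply P f \<gamma> + coeff_apply Q f \<gamma>"
proof -
  have "(\<Sum>k\<in>Poly_Mapping.keys P. G k (Poly_Mapping.lookup P k)) = coeff_apply P f \<gamma>"
    if "G = (\<lambda>k x. x * (falling (\<gamma> - nvec (fst k) + nvec (snd k)) (snd k) * f (\<gamma> - nvec (fst k) + nvec (snd k))))" for P G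
    unfolding coeff_apply_def that by (simp add: case_prod_unfold)
  from this [OF refl, symmetric] show ?thesis
    by (simp only:) (rule setsum_keys_plus_distrib, simp_all add: distrib_right)
qed

lemma coeff_apply_0 [simp]: "coeff_apply 0 f \<gamma> = 0"
  by (simp add: coeff_apply_def)

lemma coeff_apply_sum: "coeff_apply (\<Sum>i\<in>S. P i) f \<gamma> = (\<Sum>i\<in>S. coeff_apply (P i) f \<gamma>)"
  by (induction S rule: infinite_finite_induct) (simp_all add: coeff_apply_add)

lemma coeff_apply_weyl_mult:
  fixes P Q :: "('n::finite, 'k::field_char_0) weyl"
  shows "coeff_apply (weyl_mult P Q) f = coeff_apply P (coeff_apply Q f)"
proof
  fix \<gamma> :: "'k^'n"
  have summand: "(\<Sum>k | k \<le> b \<and> k \<le> c. coeff_apply (Poly_Mapping.single (a + (c - k), (b - k) + e)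
         (p * q * of_nat (\<Prod>i\<in>UNIV. fact (k $ i) * (b $ i choose k $ i) * (c $ i choose k $ i)))) f \<gamma>) =
      p * (falling (\<gamma> - nvec a + nvec b) b * (q * (falling (\<gamma> - nvec a + nvec b - nvec c + nvec e) e *
        f (\<gamma> - nvec a + nvec b - nvec c + nvec e))))" (is "?l = _")
    for a b c e :: "nat^'n" and p q :: 'k
  proof -
    define \<delta> where "\<delta> = \<gamma> - nvec a + nvec b"
    have shift: "\<gamma> - nvec (a + (c - k)) + nvec (e + (b - k)) = \<delta> - nvec c + nvec e"
      if "k \<le> b" "k \<le> c" for k
    proof (rule vec_eq_iff [THEN iffD2], intro allI)
      fix i
      have "k $ i \<le> b $ i" "k $ i \<le> c $ i" using that by (auto simp: less_eq_vec_def)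
      then show "(\<gamma> - nvec (a + (c - k)) + nvec (e + (b - k))) $ i = (\<delta> - nvec c + nvec e) $ i"
        by (simp add: \<delta>_def of_nat_diff del: add_diff_assoc add_diff_assoc2)
    qed
    have "?l = (\<Sum>k | k \<le> b \<and> k \<le> c. (p * q * falling (\<delta> - nvec c + nvec e) e * f (\<delta> - nvec c + nvec e)) *
       (of_nat (\<Prod>i\<in>UNIV. fact (k $ i) * (b $ i choose k $ i) * (c $ i choose k $ i)) *
        falling (\<delta> - nvec c) (b - k)))"
    proof (rule sum.cong)
      fix k assume "k \<in> {k. k \<le> b \<and> k \<le> c}"
      then have k: "k \<le> b" "k \<le> c" by auto
      show "coeff_apply (Poly_Mapping.single (a + (c - k), (b - k) + e)
         (p * q * of_nat (\<Prod>i\<in>UNIV. fact (k $ i) * (b $ i choose k $ i) * (c $ i choose k $ i)))) f \<gamma> =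
         (p * q * falling (\<delta> - nvec c + nvec e) e * f (\<delta> - nvec c + nvec e)) *
         (of_nat (\<Prod>i\<in>UNIV. fact (k $ i) * (b $ i choose k $ i) * (c $ i choose k $ i)) *
         falling (\<delta> - nvec c) (b - k))"
        unfolding coeff_apply_single shift [OF k] add.commute [of "b - k" e] falling_add
        by (simp add: mult_ac)
    qed simp
    also have "\<dots> = p * q * falling (\<delta> - nvec c + nvec e) e * f (\<delta> - nvec c + nvec e) * falling \<delta> b"
      unfolding sum_distrib_left [symmetric] falling_Leibniz ..
    finally show ?thesis by (simp add: \<delta>_def mult_ac)
  qed
  have "coeff_apply (weyl_mult P Q) f \<gamma> =
      (\<Sum>(a, b)\<in>Poly_Mapping.keys P. \<Sum>(c, e)\<in>Poly_Mapping.keys Q.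
        Poly_Mapping.lookup P (a, b) * (falling (\<gamma> - nvec a + nvec b) b *
         (Poly_Mapping.lookup Q (c, e) * (falling (\<gamma> - nvec a + nvec b - nvec c + nvec e) e *
        f (\<gamma> - nvec a + nvec b - nvec c + nvec e)))))"
    unfolding weyl_mult_def coeff_apply_sum case_prod_unfold summand ..
  also have "\<dots> = coeff_apply P (coeff_apply Q f) \<gamma>"
    unfolding coeff_apply_def by (simp add: sum_distrib_left case_prod_unfold)
  finally show "coeff_apply (weyl_mult P Q) f \<gamma> = coeff_apply P (coeff_apply Q f) \<gamma>" .
qed

lemma coeff_apply_left_ideal:
  fixes P :: "('n::finite, 'k::field_char_0) weyl"
  assumes "P \<in> left_ideal S" and "\<And>Q. Q \<in> S \<Longrightarrow> coeff_apply Q f = (\<lambda>_. 0)"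
  shows "coeff_apply P f = (\<lambda>_. 0)"
  using assms(1)
proof induction
  case (mult Q P)
  then show ?case
    unfolding coeff_apply_weyl_mult by (simp add: coeff_apply_def)
qed (use assms(2) in \<open>auto simp: coeff_apply_add\<close>)

lemma weyl_of_pol_add: "weyl_of_pol (p + q) = weyl_of_pol p + weyl_of_pol q"
  unfolding weyl_of_pol_def by (rule setsum_keys_plus_distrib) (simp_all add: single_add)

lemma weyl_of_pol_single: "weyl_of_pol (Poly_Mapping.single t c) = Poly_Mapping.single (0, t) c"
  by (simp add: weyl_of_pol_def)

lemma weyl_of_pol_diff: "weyl_of_pol (p - q) = weyl_of_pol p - weyl_of_pol q"
  using weyl_of_pol_add [of "p - q" q] by simp

lemma coeff_apply_diff: "coeff_apply (P - Q) f \<gamma> = coeff_apply P f \<gamma> - coeff_apply Q f \<gamma>"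
  using coeff_apply_add [of "P - Q" Q] by (simp add: algebra_simps)

lemma coeff_apply_euler_op:
  fixes f :: "'k::comm_ring_1^'n::finite \<Rightarrow> 'k"
  shows "coeff_apply (euler_op A \<beta> i) f \<gamma> = ((imat A *v \<gamma>) $ i - \<beta> $ i) * f \<gamma>"
proof -
  have "falling \<gamma> (axis j 1) = \<gamma> $ j" for j
    unfolding falling_ffact
    by (subst prod.remove [of _ j]) (auto simp: axis_def ffact_def intro!: prod.neutral)
  then have "coeff_apply (\<Sum>j\<in>UNIV. Poly_Mapping.single (axis j 1, axis j 1) (of_int (A $ i $ j))) f \<gamma> =
      (imat A *v \<gamma>) $ i * f \<gamma>"
    by (simp add: coeff_apply_sum coeff_apply_single matrix_vector_mult_def imat_def map_matrix_def
        sum_distrib_right mult.assoc)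
  then show ?thesis
    unfolding euler_op_def coeff_apply_diff coeff_apply_single
    by (simp add: falling_ffact left_diff_distrib)
qed

lemma const_mult: "const c * const d = const (c * d :: 'k::semiring_1)"
  by (simp add: const_def mult_single)

lemma const_add: "const c + const d = const (c + d :: 'k::comm_monoid_add)"
  by (simp add: const_def single_add)

lemma const_0 [simp]: "const 0 = 0"
  by (simp add: const_def)

lemma const_sum: "const (\<Sum>i\<in>S. c i) = (\<Sum>i\<in>S. const (c i :: 'k::comm_monoid_add))"
  by (induction S rule: infinite_finite_induct) (simp_all flip: const_add)

lemma const_eq_0_iff [simp]: "const c = 0 \<longleftrightarrow> c = 0"
  by (metis const_0 const_def lookup_single_eq)

lemma pdiff_const [simp]: "pdiff i (const c) = 0"
  by (simp add: pdiff_def const_def)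

text \<open>If the part of a series with exponent \<open>\<gamma> + b\<close> has no logarithms, then so does the part of its
\<open>b\<close>-th derivative with exponent \<open>\<gamma>\<close>, whatever the other parts of the series are.\<close>

lemma series_diff_funpow:
  fixes f :: "('n::finite, 'k::comm_ring_1) logseries"
  assumes "f (\<gamma> + nvec (axis i n)) = const c"
  shows "(series_diff i ^^ n) f \<gamma> = const (ffact (\<gamma> $ i + of_nat n) n * c)"
  using assms
proof (induction n arbitrary: \<gamma>)
  case 0
  have "nvec (axis i 0) = (0 :: 'k^'n)"
    by (simp add: vec_eq_iff axis_def)
  then show ?case using 0 by simp
next
  case (Suc n)
  have "\<gamma> + axis i 1 + nvec (axis i n) = \<gamma> + nvec (axis i (Suc n))"
    by (auto simp: vec_eq_iff axis_def)
  then have "(series_diff i ^^ n) f (\<gamma> + axis i 1) = const (ffact ((\<gamma> + axis i 1) $ i + of_nat n) n * c)"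
    using Suc.prems by (intro Suc.IH) (simp only:)
  then have "(series_diff i ^^ Suc n) f \<gamma> =
      const (\<gamma> $ i + 1) * const (ffact (\<gamma> $ i + 1 + of_nat n) n * c)"
    by (simp add: series_diff_def)
  also have "\<dots> = const (ffact (\<gamma> $ i + of_nat (Suc n)) (Suc n) * c)"
    by (simp add: const_mult ffact_def algebra_simps)
  finally show ?case .
qed

lemma fold_series_diff:
  fixes f :: "('n::finite, 'k::comm_ring_1) logseries"
  assumes "distinct xs" "f (\<gamma> + (\<Sum>i\<in>set xs. nvec (axis i (b $ i)))) = const c"
  shows "fold (\<lambda>i. series_diff i ^^ (b $ i)) xs f \<gamma> =
    const ((\<Prod>i\<in>set xs. ffact (\<gamma> $ i + of_nat (b $ i)) (b $ i)) * c)"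
  using assms
proof (induction xs arbitrary: f c)
  case Nil
  then show ?case by simp
next
  case (Cons i xs)
  let ?s = "\<Sum>i\<in>set xs. nvec (axis i (b $ i)) :: 'k^'n"
  have "f (\<gamma> + ?s + nvec (axis i (b $ i))) = const c"
    using Cons.prems by (simp add: add_ac)
  then have "(series_diff i ^^ (b $ i)) f (\<gamma> + ?s) = const (ffact ((\<gamma> + ?s) $ i + of_nat (b $ i)) (b $ i) * c)"
    by (rule series_diff_funpow)
  moreover have "?s $ i = 0"
    using Cons.prems(1) by (auto simp: axis_def intro!: sum.neutral)
  ultimately have "(series_diff i ^^ (b $ i)) f (\<gamma> + ?s) = const (ffact (\<gamma> $ i + of_nat (b $ i)) (b $ i) * c)"
    by simp
  with Cons.prems(1) show ?case
    by (simp add: Cons.IH mult_ac)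
qed

lemma series_diffs_const:
  fixes f :: "('n::{finite,linorder}, 'k::comm_ring_1) logseries"
  assumes "f (\<gamma> + nvec b) = const c"
  shows "series_diffs b f \<gamma> = const (falling (\<gamma> + nvec b) b * c)"
proof -
  have "(\<Sum>i\<in>UNIV. nvec (axis i (b $ i))) = (nvec b :: ('k, 'n) vec)"
    by (simp add: vec_eq_iff axis_def if_distrib [of of_nat] cong: if_cong)
  then show ?thesis
    unfolding series_diffs_def using fold_series_diff [of "sorted_list_of_set UNIV" f \<gamma> b c] assms
    by (simp add: falling_ffact)
qed

lemma weyl_apply_const:
  "weyl_apply P (\<lambda>\<gamma>. const (f \<gamma>)) = (\<lambda>\<gamma>. const (coeff_apply P f \<gamma>))"
  unfolding weyl_apply_def coeff_apply_def const_sum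
  by (simp add: series_diffs_const [OF refl] const_mult case_prod_unfold)

text \<open>A logarithm-free series is hypergeometric as soon as its support lies in the fiber of \<open>\<beta>\<close> and the
binomials annihilate it.\<close>

lemma hypergeometric_const:
  fixes f :: "('k::field_char_0)^('n::{finite,linorder}) \<Rightarrow> 'k"
  assumes euler: "\<And>\<gamma>. f \<gamma> \<noteq> 0 \<Longrightarrow> imat A *v \<gamma> = \<beta>"
    and toric: "\<And>s t \<gamma>. A *v nvec s = A *v nvec t \<Longrightarrow>
      falling (\<gamma> + nvec s) s * f (\<gamma> + nvec s) = falling (\<gamma> + nvec t) t * f (\<gamma> + nvec t)"
  shows "hypergeometric A \<beta> (\<lambda>\<gamma>. const (f \<gamma>))"
proof -
  have "coeff_apply P f = (\<lambda>_. 0)" if "P \<in> hyp_ideal A \<beta>" for P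
    using that unfolding hyp_ideal_def
  proof (rule coeff_apply_left_ideal)
    fix Q assume Q: "Q \<in> weyl_of_pol ` toric_ideal A \<union> range (euler_op A \<beta>)"
    show "coeff_apply Q f = (\<lambda>_. 0)"
    proof (cases "Q \<in> range (euler_op A \<beta>)")
      case True
      then obtain i where i: "Q = euler_op A \<beta> i" by auto
      have "((imat A *v \<gamma>) $ i - \<beta> $ i) * f \<gamma> = 0" for \<gamma>
        using euler [of \<gamma>] by (cases "f \<gamma> = 0") simp_all
      then show ?thesis unfolding i by (intro ext) (simp only: coeff_apply_euler_op)
    next
      case False
      then obtain p where p: "p \<in> toric_ideal A" "Q = weyl_of_pol p" using Q by auto
      have "coeff_apply (weyl_of_pol p) f = (\<lambda>_. 0)"
        using p(1)
      proof (induction rule: toric_ideal_induct)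
        case zero
        show ?case by (simp add: weyl_of_pol_def coeff_apply_def)
      next
        case (add p q)
        then show ?case by (simp add: weyl_of_pol_add coeff_apply_add fun_eq_iff)
      next
        case (binomial u v c)
        then show ?case
          using toric [of u v]
          by (simp add: weyl_of_pol_diff weyl_of_pol_single coeff_apply_diff coeff_apply_single fun_eq_iff)
      qed
      then show ?thesis using p by simp
    qed
  qed
  then show ?thesis
    by (simp add: hypergeometric_def weyl_apply_const)
qed

lemma hypergeometric_binomial:
  fixes f :: "('n::{finite,linorder}, 'k::comm_ring_1) logseries"
  assumes "hypergeometric A \<beta> f" "A *v nvec s = A *v nvec t"
  shows "series_diffs s f \<gamma> = series_diffs t f \<gamma>"
proof (cases "s = t")
  case False
  let ?P = "Poly_Mapping.single (0, s) 1 - Poly_Mapping.single (0, t) 1 :: ('n, 'k) weyl"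
  have "weyl_of_pol (monomial s - monomial t) \<in> (hyp_ideal A \<beta> :: ('n, 'k) weyl set)"
    unfolding hyp_ideal_def
    by (intro left_ideal.base UnI1 imageI binomial_in_toric_ideal assms)
  then have "weyl_apply ?P f \<gamma> = 0"
    using assms(1) unfolding hypergeometric_def weyl_of_pol_diff weyl_of_pol_single by metis
  moreover have "Poly_Mapping.keys ?P = {(0, s), (0, t)}"
    using False by (auto simp: in_keys_iff lookup_minus lookup_single when_def split: if_splits)
  moreover have "const 1 = (1 :: ('n, 'k) pol)" "const (-1) = (-1 :: ('n, 'k) pol)"
    by (simp_all add: const_def single_uminus)
  ultimately show ?thesis
    using False by (simp add: weyl_apply_def lookup_minus lookup_single when_def)
qed simp

section \<open>The series phi are hypergeometric\<close>

text \<open>Being a negative integer; \<open>nsupp v\<close> collects the coordinates of \<open>v\<close> with this property.\<close>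

definition neg_int :: "'k::ring_1 \<Rightarrow> bool" where
  "neg_int x \<longleftrightarrow> (\<exists>m::int. m < 0 \<and> x = of_int m)"

lemma mem_nsupp: "j \<in> nsupp v \<longleftrightarrow> neg_int (v $ j)"
  by (simp add: nsupp_def neg_int_def)

text \<open>A value for the quotient \<open>\<Gamma>(x + 1) / \<Gamma>(x + m + 1)\<close>; the coefficient of \<open>x^(v + u)\<close> in the series \<open>phi\<close>
is the product of these quotients at \<open>(v_j, u_j)\<close>.\<close>

definition gamma_ratio :: "'k::field \<Rightarrow> int \<Rightarrow> 'k" where
  "gamma_ratio x m = ffact x (nat (- m)) / ffact (x + of_int m) (nat m)"

lemma ffact_nonzero:
  fixes x :: "'k::field_char_0"
  assumes "neg_int x \<longleftrightarrow> neg_int (x + of_int m)"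
  shows "ffact (x + of_int m) (nat m) \<noteq> 0"
proof
  assume "ffact (x + of_int m) (nat m) = 0"
  then obtain k where k: "k < nat m" "x + of_int m - of_nat k = 0"
    by (auto simp: ffact_def)
  then have x: "x = of_int (int k - m)" by (simp add: algebra_simps)
  then have "neg_int x" using k(1) unfolding neg_int_def by (intro exI [of _ "int k - m"]) auto
  then obtain l where "l < 0" "x + of_int m = of_int l" using assms by (auto simp: neg_int_def)
  then have "of_int (int k) = (of_int l :: 'k)" using x by simp
  then show False using \<open>l < 0\<close> by (simp only: of_int_eq_iff)
qed

text \<open>The functional equation of the Gamma function.  Either both or none of \<open>x\<close> and \<open>x + m\<close> must be
negative integers, but nothing is required of \<open>x + m - t\<close>.\<close>

lemma gamma_ratio_step:
  fixes x :: "'k::field_char_0"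
  assumes "neg_int x \<longleftrightarrow> neg_int (x + of_int m)"
  shows "ffact (x + of_int m) t * gamma_ratio x m = gamma_ratio x (m - int t)"
proof (cases "m < 0")
  case True
  have "nat (- (m - int t)) = nat (- m) + t" "of_nat (nat (- m)) = (- of_int m :: 'k)"
    using True by (auto simp: of_nat_nat)
  then show ?thesis using True by (simp add: gamma_ratio_def ffact_add mult.commute)
next
  case False
  note nz = ffact_nonzero [OF assms]
  show ?thesis
  proof (cases "int t \<le> m")
    case True
    have "nat m = t + nat (m - int t)" using True by simp
    then have "ffact (x + of_int m) (nat m) =
        ffact (x + of_int m) t * ffact (x + of_int m - of_nat t) (nat (m - int t))"
      using ffact_add by metis
    then show ?thesis using nz True False by (simp add: gamma_ratio_def add_diff_eq)
  next
    case False
    have "t = nat m + nat (int t - m)" using False \<open>\<not> m < 0\<close> by simp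
    then have "ffact (x + of_int m) t =
        ffact (x + of_int m) (nat m) * ffact (x + of_int m - of_nat (nat m)) (nat (int t - m))"
      using ffact_add by metis
    then show ?thesis using nz False \<open>\<not> m < 0\<close> by (simp add: gamma_ratio_def of_nat_nat)
  qed
qed

text \<open>The coefficient function of the logarithm-free series \<open>phi\<close>, with values in the field.\<close>

definition phi_coeff :: "int^'n::finite^'d \<Rightarrow> ('k::field_char_0)^'n \<Rightarrow> 'k^'n \<Rightarrow> 'k" where
  "phi_coeff A v \<gamma> = (\<Sum>u | u \<in> nsupp_class A v \<and> v + ivec u = \<gamma>.
     falling v (neg_part u) / falling (v + ivec u) (pos_part u))"

lemma phi_eq: "phi A v = (\<lambda>\<gamma>. const (phi_coeff A v \<gamma>))"
  by (simp add: phi_def phi_coeff_def const_sum)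

lemma phi_coeff_shift:
  "phi_coeff A v (v + ivec u) = (if u \<in> nsupp_class A v then \<Prod>j\<in>UNIV. gamma_ratio (v $ j) (u $ j) else 0)"
proof -
  have "{u'. u' \<in> nsupp_class A v \<and> v + ivec u' = v + ivec u} = (if u \<in> nsupp_class A v then {u} else {})"
    by auto
  then show ?thesis
    by (simp add: phi_coeff_def falling_ffact gamma_ratio_def neg_part_def pos_part_def prod_dividef)
qed

lemma phi_coeff_nonzeroE:
  assumes "phi_coeff A v \<gamma> \<noteq> 0"
  obtains u where "u \<in> nsupp_class A v" "\<gamma> = v + ivec u"
proof -
  have "{u. u \<in> nsupp_class A v \<and> v + ivec u = \<gamma>} \<noteq> {}"
    using assms unfolding phi_coeff_def by (metis sum.empty)
  then show ?thesis using that by blast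
qed

lemma nsupp_class_neg_int:
  assumes "u \<in> nsupp_class A v"
  shows "neg_int (v $ j) \<longleftrightarrow> neg_int (v $ j + of_int (u $ j))"
  using assms by (auto simp: nsupp_class_def mem_nsupp set_eq_iff)

text \<open>Both sides equal the product of the \<open>gamma_ratio\<close>s at \<open>\<gamma> - v\<close> when both exponents belong to the
support.  When only one of them does, minimality of the negative support provides a coordinate
that crosses from nonnegative to negative, where the falling factorial vanishes.\<close>

lemma phi_coeff_toric:
  fixes v :: "'k::field_char_0^'n::finite"
  assumes min: "minimal_nsupp A v" and st: "A *v nvec s = A *v nvec t"
  shows "falling (\<gamma> + nvec s) s * phi_coeff A v (\<gamma> + nvec s) =
    falling (\<gamma> + nvec t) t * phi_coeff A v (\<gamma> + nvec t)"
proof -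
  have step: "falling (v + ivec u) s * phi_coeff A v (v + ivec u) =
      (\<Prod>j\<in>UNIV. gamma_ratio (v $ j) (u $ j - int (s $ j)))" if "u \<in> nsupp_class A v" for u s
    using that unfolding phi_coeff_shift falling_ffact
    by (simp flip: prod.distrib) (intro prod.cong refl gamma_ratio_step nsupp_class_neg_int)
  have half: "falling (\<gamma> + nvec s) s * phi_coeff A v (\<gamma> + nvec s) =
      falling (\<gamma> + nvec t) t * phi_coeff A v (\<gamma> + nvec t)"
    if nz: "phi_coeff A v (\<gamma> + nvec s) \<noteq> 0" and st: "A *v nvec s = A *v nvec t" for s t
  proof -
    obtain u where u: "u \<in> nsupp_class A v" "\<gamma> + nvec s = v + ivec u"
      using nz by (rule phi_coeff_nonzeroE)
    define u' where "u' = u - nvec s + nvec t"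
    have u': "\<gamma> + nvec t = v + ivec u'"
      using u(2) by (simp add: u'_def ivec_add ivec_diff) (simp add: algebra_simps)
    have ker: "u' \<in> kernel_lattice A"
      using u(1) st by (simp add: u'_def kernel_lattice_def nsupp_class_def
          matrix_vector_right_distrib matrix_vector_mult_diff_distrib)
    show ?thesis
    proof (cases "u' \<in> nsupp_class A v")
      case True
      then show ?thesis
        unfolding u' u(2) by (simp add: step u(1)) (simp add: u'_def)
    next
      case False
      have "nsupp (v + ivec u') \<noteq> nsupp v" "\<not> nsupp (v + ivec u') \<subset> nsupp v"
        using False ker min by (auto simp: nsupp_class_def minimal_nsupp_def)
      then obtain j where j: "j \<in> nsupp (v + ivec u')" "j \<notin> nsupp v" by blast
      then obtain m where m: "m < 0" "v $ j + of_int (u' $ j) = of_int m"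
        by (auto simp: nsupp_def)
      define m' where "m' = m - int (t $ j) + int (s $ j)"
      have m': "(v + ivec u) $ j = of_int m'"
        using m(2) by (simp add: m'_def u'_def algebra_simps)
      have "j \<notin> nsupp (v + ivec u)" using j(2) u(1) by (simp add: nsupp_class_def)
      then have "m' \<ge> 0" using m' by (force simp: nsupp_def)
      moreover have "m' < int (s $ j)" using m(1) by (simp add: m'_def)
      ultimately have "ffact ((v + ivec u) $ j) (s $ j) = 0" unfolding m' by (rule ffact_eq_0)
      then have "falling (v + ivec u) s = 0"
        unfolding falling_ffact by (intro prod_zero) auto
      then show ?thesis using False unfolding u' u(2) by (simp add: phi_coeff_shift)
    qed
  qed
  show ?thesis
    by (cases "phi_coeff A v (\<gamma> + nvec s) = 0"; cases "phi_coeff A v (\<gamma> + nvec t) = 0")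
      (use half [of s t] half [of t s] st in auto)
qed

lemma hypergeometric_phi:
  fixes v :: "('k::field_char_0)^('n::{finite,linorder})"
  assumes "minimal_nsupp A v" "imat A *v v = \<beta>"
  shows "hypergeometric A \<beta> (phi A v)"
  unfolding phi_eq
proof (rule hypergeometric_const)
  fix \<gamma> assume "phi_coeff A v \<gamma> \<noteq> 0"
  then obtain u where "u \<in> nsupp_class A v" "\<gamma> = v + ivec u" by (rule phi_coeff_nonzeroE)
  then show "imat A *v \<gamma> = \<beta>"
    using assms(2) by (simp add: matrix_vector_right_distrib imat_ivec nsupp_class_def kernel_lattice_def)
qed (rule phi_coeff_toric [OF assms(1)])

section \<open>Canonical series\<close>

text \<open>A polynomial whose lexicographically leading monomial is \<open>1\<close> is constant.\<close>

lemma lex_lead_eq_0D: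
  fixes g :: "('n::{finite,linorder}, 'k::zero) pol"
  assumes "g \<noteq> 0" "lex_lead g = 0"
  obtains c where "c \<noteq> 0" "g = const c"
proof -
  let ?K = "Poly_Mapping.keys g"
  let ?max = "\<lambda>t. t \<in> ?K \<and> (\<forall>s\<in>?K. s \<noteq> t \<longrightarrow> less_fun (($) s) (($) t))"
  have "\<exists>t\<in>K. \<forall>s\<in>K. s \<noteq> t \<longrightarrow> less_fun (($) s) (($) t)"
    if "finite K" "K \<noteq> {}" for K :: "(nat, 'n) vec set"
    using that
  proof (induction rule: finite_ne_induct)
    case (singleton x)
    then show ?case by simp
  next
    case (insert x K)
    then obtain t where t: "t \<in> K" "\<And>s. s \<in> K \<Longrightarrow> s \<noteq> t \<Longrightarrow> less_fun (($) s) (($) t)" by blast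
    have "less_fun (($) x) (($) t) \<or> x = t \<or> less_fun (($) t) (($) x)"
      using less_fun_trichotomy [of "($) x" "($) t"] by (auto simp: vec_eq_iff fun_eq_iff)
    then show ?case
      using t insert.hyps by (metis insert_iff less_fun_trans)
  qed
  from this [of ?K] assms(1) obtain t where t: "?max t" by auto
  moreover have "t' = t" if "?max t'" for t'
    using t that by (metis less_fun_asym)
  ultimately have "lex_lead g = t"
    unfolding lex_lead_def by (rule the_equality)
  then have t0: "?max 0" using t assms(2) by simp
  have "s = 0" if "s \<in> ?K" for s
  proof (rule ccontr)
    assume "s \<noteq> 0"
    then have "less_fun (($) s) (($) 0)" using t0 that by blast
    then show False by (rule less_funE) simp
  qed
  then have "g = const (Poly_Mapping.lookup g 0)"
    by (intro poly_mapping_eqI) (auto simp: const_def lookup_single when_def in_keys_iff)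
  moreover have "Poly_Mapping.lookup g 0 \<noteq> 0" using t0 by (simp add: in_keys_iff)
  ultimately show ?thesis using that by blast
qed

lemma keys_const: "Poly_Mapping.keys (const c) = (if c = 0 then {} else {0})"
  by (simp add: const_def)

lemma lex_lead_const:
  assumes "c \<noteq> 0"
  shows "lex_lead (const c :: ('n::{finite,linorder}, 'k::zero) pol) = 0"
  unfolding lex_lead_def keys_const using assms by (intro the_equality) auto

lemma in_direction_nonneg:
  fixes f :: "('n::finite, 'k::field_char_0) logseries"
  assumes "in_direction A w \<gamma> f" "f (\<gamma> + ivec u) \<noteq> 0"
  shows "w \<bullet> ivec u \<ge> 0"
proof -
  obtain B where B: "\<And>b. b \<in> B \<Longrightarrow> w \<bullet> qvec b > 0"
    and f: "\<And>\<delta>. f \<delta> \<noteq> 0 \<Longrightarrow> \<exists>u\<in>kernel_lattice A. \<delta> = \<gamma> + ivec u \<and> ivec u \<in> rat_cone B"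
    using assms(1) unfolding in_direction_def by blast
  obtain u' where "\<gamma> + ivec u = \<gamma> + ivec u'" "ivec u' \<in> rat_cone B"
    using f assms(2) by blast
  then have "ivec u \<in> rat_cone B" by simp
  then obtain c where c: "ivec u = (\<Sum>b\<in>B. c b *s b)" "\<And>b. b \<in> B \<Longrightarrow> c b \<ge> 0"
    by (auto simp: rat_cone_def)
  have "(ivec u :: real^'n) = qvec (ivec u)"
    by (simp add: vec_eq_iff qvec_def)
  also have "\<dots> = (\<Sum>b\<in>B. of_rat (c b) *\<^sub>R qvec b)"
    unfolding c(1) by (simp add: vec_eq_iff qvec_def of_rat_sum of_rat_mult)
  finally have "w \<bullet> ivec u = (\<Sum>b\<in>B. of_rat (c b) * (w \<bullet> qvec b))"
    by (simp add: inner_sum_right)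
  also have "\<dots> \<ge> 0"
    using B c(2) by (intro sum_nonneg mult_nonneg_nonneg) (auto simp: less_imp_le)
  finally show ?thesis .
qed

lemma phi_start: "phi A v v = const 1"
proof -
  have "0 \<in> nsupp_class A v"
    by (simp add: nsupp_class_def kernel_lattice_def)
  then show ?thesis
    using phi_coeff_shift [of A v 0] by (simp add: phi_eq gamma_ratio_def)
qed

text \<open>Suppose that the monomial \<open>x^(v + u)\<close> with \<open>u \<noteq> 0\<close> of \<open>phi\<close> starts a series \<open>f\<close> in the direction of \<open>w\<close>.
As \<open>w \<bullet> u > 0\<close>, the series \<open>f\<close> has no terms with exponent \<open>v\<close>.  But \<open>\<partial>^(u_+) f = \<partial>^(u_-) f\<close>, and
comparing the parts with exponent \<open>v - u_-\<close> gives a contradiction: on the left it is a nonzero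
multiple of the starting coefficient of \<open>f\<close>.\<close>

lemma canonical_phi:
  fixes v :: "('k::field_char_0)^('n::{finite,linorder})"
  assumes min: "minimal_nsupp A v" and v: "imat A *v v = \<beta>"
    and pos: "\<And>u. u \<in> nsupp_class A v \<Longrightarrow> u \<noteq> 0 \<Longrightarrow> w \<bullet> ivec u > 0"
    and dir: "in_direction A w v (phi A v)"
  shows "canonical A \<beta> w v (phi A v)"
proof -
  have "(\<gamma>, b) = (v, lex_lead (phi A v v))"
    if start: "(\<gamma>, b) \<in> starting_monomials A \<beta> w" and b: "b \<in> Poly_Mapping.keys (phi A v \<gamma>)" for \<gamma> b
  proof -
    have b0: "b = 0" and "phi_coeff A v \<gamma> \<noteq> 0"
      using b by (auto simp: phi_eq keys_const split: if_splits)
    then obtain u where u: "u \<in> nsupp_class A v" "\<gamma> = v + ivec u"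
      by (elim phi_coeff_nonzeroE)
    have "u = 0"
    proof (rule ccontr)
      assume "u \<noteq> 0"
      then have wu: "w \<bullet> ivec u > 0" using pos u(1) by blast
      obtain f where f: "hypergeometric A \<beta> f" "in_direction A w \<gamma> f" "f \<gamma> \<noteq> 0" "lex_lead (f \<gamma>) = 0"
        using start b0 by (auto simp: starting_monomials_def)
      obtain c where c: "c \<noteq> 0" "f \<gamma> = const c" using f(3,4) by (rule lex_lead_eq_0D)
      have ker: "u \<in> kernel_lattice A" using u(1) by (simp add: nsupp_class_def)
      let ?s = "pos_part u" and ?t = "neg_part u" and ?\<delta> = "v - nvec (neg_part u)"
      have \<delta>: "?\<delta> + nvec ?s = \<gamma>"
        using nvec_pos_minus_neg [of u, where 'a = 'k] unfolding u(2) by (simp add: algebra_simps)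
      have "series_diffs ?s f ?\<delta> = const (falling \<gamma> ?s * c)"
        using series_diffs_const [of f ?\<delta> ?s c] c(2) unfolding \<delta> by simp
      moreover have "f v = 0"
      proof (rule ccontr)
        assume "f v \<noteq> 0"
        then have "f (\<gamma> + ivec (- u)) \<noteq> 0" by (simp add: u(2) ivec_diff [of 0 u, simplified])
        then have "w \<bullet> ivec (- u) \<ge> 0" by (rule in_direction_nonneg [OF f(2)])
        then show False using wu ivec_diff [of 0 u, where 'a = real] by simp
      qed
      then have "series_diffs ?t f ?\<delta> = const 0"
        using series_diffs_const [of f ?\<delta> ?t 0] by simp
      ultimately have "const (falling \<gamma> ?s * c) = (const 0 :: ('n, 'k) pol)"
        using hypergeometric_binomial [OF f(1) matrix_nvec_pos_part [OF ker], of ?\<delta>] by simp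
      then have "falling \<gamma> ?s = 0" using c(1) by simp
      moreover have "falling \<gamma> ?s \<noteq> 0"
        unfolding falling_ffact u(2)
        using ffact_nonzero [OF nsupp_class_neg_int [OF u(1)]] by (simp add: pos_part_def)
      ultimately show False by contradiction
    qed
    then show ?thesis using u(2) b0 by (simp add: phi_start lex_lead_const)
  qed
  moreover have "phi A v v \<noteq> 0" by (simp add: phi_start)
  ultimately show ?thesis
    unfolding canonical_def using hypergeometric_phi [OF min v] dir by blast
qed

lemma in_direction_phi:
  fixes v :: "('k::field_char_0)^'n::finite"
  assumes "w \<noteq> 0" "e > 0"
    and "\<And>u. u \<in> nsupp_class A v \<Longrightarrow> e * (\<Sum>j\<in>UNIV. \<bar>of_int (u $ j)\<bar>) \<le> w \<bullet> ivec u"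
  shows "in_direction A w v (phi A v)"
proof -
  obtain B :: "(rat^'n) set" where B: "vec.independent B" "vec.span B = UNIV"
    "\<And>b. b \<in> B \<Longrightarrow> w \<bullet> qvec b > 0"
    "\<And>q. w \<bullet> qvec q \<ge> e * (\<Sum>j\<in>UNIV. \<bar>of_rat (q $ j)\<bar>) \<Longrightarrow> q \<in> rat_cone B"
    using rational_cone_basis [OF assms(1,2)] by metis
  have "\<exists>u\<in>kernel_lattice A. \<gamma> = v + ivec u \<and> ivec u \<in> rat_cone B" if "phi A v \<gamma> \<noteq> 0" for \<gamma>
  proof -
    have "phi_coeff A v \<gamma> \<noteq> 0" using that by (simp add: phi_eq)
    then obtain u where u: "u \<in> nsupp_class A v" "\<gamma> = v + ivec u" by (rule phi_coeff_nonzeroE)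
    have "qvec (ivec u) = (ivec u :: real^'n)" by (simp add: vec_eq_iff qvec_def)
    then have "ivec u \<in> rat_cone B" using assms(3) [OF u(1)] by (intro B(4)) simp
    then show ?thesis using u by (auto simp: nsupp_class_def)
  qed
  then show ?thesis unfolding in_direction_def using B(1-3) by blast
qed

section \<open>Exponents that minimize the weight\<close>

lemma exists_minimizer:
  fixes f :: "'a \<Rightarrow> real"
  assumes "x0 \<in> Y" "finite {x\<in>Y. f x \<le> f x0}"
  obtains x where "x \<in> Y" "\<And>y. y \<in> Y \<Longrightarrow> f x \<le> f y"
proof -
  let ?S = "{x\<in>Y. f x \<le> f x0}"
  have "Min (f ` ?S) \<in> f ` ?S" using assms by (intro Min_in) auto
  then obtain x where x: "x \<in> ?S" "f x = Min (f ` ?S)" by auto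
  have "f x \<le> f y" if "y \<in> Y" for y
  proof (cases "f y \<le> f x0")
    case True
    then show ?thesis using that assms(2) unfolding x(2) by (intro Min_le) auto
  next
    case False
    then show ?thesis using x(1) by auto
  qed
  then show ?thesis using x(1) that by blast
qed

text \<open>An affine lower bound for a positive weight on integer vectors improves to a linear one, because
only finitely many vectors violate the latter.\<close>

lemma affine_bound_imp_linear_bound:
  fixes N :: "(int^'n::finite) set" and w :: "real^'n"
  assumes "e > 0" and bd: "\<And>u. u \<in> N \<Longrightarrow> e * (\<Sum>j\<in>UNIV. \<bar>of_int (u $ j)\<bar>) - M \<le> w \<bullet> ivec u"
    and pos: "\<And>u. u \<in> N \<Longrightarrow> u \<noteq> 0 \<Longrightarrow> w \<bullet> ivec u > 0"
  obtains e' where "e' > 0" "\<And>u. u \<in> N \<Longrightarrow> e' * (\<Sum>j\<in>UNIV. \<bar>of_int (u $ j)\<bar>) \<le> w \<bullet> ivec u"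
proof -
  define l where "l u = (\<Sum>j\<in>UNIV. \<bar>of_int (u $ j) :: real\<bar>)" for u :: "int^'n"
  define S where "S = {u\<in>N. u \<noteq> 0 \<and> l u \<le> 2 * M / e}"
  have "finite S"
    by (rule finite_subset [OF _ finite_bounded_int_vec [of "2 * M / e"]]) (auto simp: S_def l_def)
  define e' where "e' = Min (insert (e / 2) ((\<lambda>u. w \<bullet> ivec u / l u) ` S))"
  have l: "l u > 0" if "u \<noteq> 0" for u
  proof -
    have "\<exists>j. u $ j \<noteq> 0" using that by (simp add: vec_eq_iff)
    then obtain j where "u $ j \<noteq> 0" ..
    then show ?thesis unfolding l_def by (intro sum_pos2 [of _ j]) auto
  qed
  have "e' > 0"
    using \<open>finite S\<close> \<open>e > 0\<close> l pos by (auto simp: e'_def S_def)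
  moreover have "e' * l u \<le> w \<bullet> ivec u" if u: "u \<in> N" for u
  proof (cases "u = 0")
    case True
    then show ?thesis by (simp add: l_def)
  next
    case False
    show ?thesis
    proof (cases "l u \<le> 2 * M / e")
      case True
      then have "e' \<le> w \<bullet> ivec u / l u"
        unfolding e'_def using \<open>finite S\<close> u False by (intro Min_le) (auto simp: S_def)
      then show ?thesis using l [OF False] by (simp add: field_simps)
    next
      case large: False
      have "e' \<le> e / 2" unfolding e'_def using \<open>finite S\<close> by (intro Min_le) auto
      then have "e' * l u \<le> e / 2 * l u" using l [OF False] by (intro mult_right_mono) auto
      also have "\<dots> \<le> e * l u - M" using large \<open>e > 0\<close> by (simp add: field_simps)
      also have "\<dots> \<le> w \<bullet> ivec u" using bd [OF u] by (simp add: l_def)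
      finally show ?thesis .
    qed
  qed
  ultimately show ?thesis using that by (simp add: l_def)
qed

lemma not_neg_int_of_nat [simp]: "\<not> neg_int (of_nat m :: 'k::ring_char_0)"
proof
  assume "neg_int (of_nat m :: 'k)"
  then obtain l where "l < 0" "of_int (int m) = (of_int l :: 'k)" by (auto simp: neg_int_def)
  then show False by (simp only: of_int_eq_iff)
qed

lemma not_in_nsuppD: "j \<notin> nsupp v \<Longrightarrow> v $ j = of_int m \<Longrightarrow> m \<ge> 0"
  unfolding nsupp_def by (metis (mono_tags, lifting) mem_Collect_eq not_le)

text \<open>Among the exponents in \<open>v0 + L\<close> with natural coordinates outside \<open>I\<close>, first minimize the negative
support and then the weight.  If \<open>w \<bullet> u = 0\<close> for a nonzero \<open>u\<close> in the support of the
resulting series, then replacing \<open>u_+\<close> by an exponent \<open>t\<close> of smaller weight in the same fiber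
leads to \<open>v + t - u_-\<close>, which has no larger negative support and smaller weight than \<open>v\<close>.\<close>

lemma exists_minimal_exponent:
  fixes A :: "int^'n::finite^'d::finite" and \<beta> :: "'k::field_char_0^'d" and v0 :: "'k^'n"
  assumes gen: "generic_weight A \<beta> w" and hyp: "on_hyperplane_off_origin A"
    and face: "I \<in> regular_faces A w" and v0: "\<And>j. j \<notin> I \<Longrightarrow> v0 $ j \<in> \<nat>"
  obtains u e where "u \<in> kernel_lattice A" "minimal_nsupp A (v0 + ivec u)"
    "\<And>j. j \<notin> I \<Longrightarrow> (v0 + ivec u) $ j \<in> \<nat>" "e > 0"
    "\<And>u'. u' \<in> nsupp_class A (v0 + ivec u) \<Longrightarrow> e * (\<Sum>j\<in>UNIV. \<bar>of_int (u' $ j)\<bar>) \<le> w \<bullet> ivec u'"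
proof -
  obtain c :: "real^'d" where c: "\<And>j. j \<in> I \<Longrightarrow> c \<bullet> ivec (column j A) = w $ j"
    "\<And>j. j \<notin> I \<Longrightarrow> c \<bullet> ivec (column j A) < w $ j"
    using regular_face_covector [OF hyp face] by metis
  note ind = regular_face_independent [OF gen c]
  have bound: "\<exists>e M. e > 0 \<and> (\<forall>u\<in>kernel_lattice A. (\<forall>j. j \<notin> I \<longrightarrow> (v + ivec u) $ j \<in> \<nat>) \<longrightarrow>
      e * (\<Sum>j\<in>UNIV. \<bar>of_int (u $ j)\<bar>) - M \<le> w \<bullet> ivec u)"
    if v: "\<And>j. j \<notin> I \<Longrightarrow> v $ j \<in> \<nat>" for v :: "'k^'n"
  proof -
    have "\<forall>j. \<exists>n. j \<notin> I \<longrightarrow> v $ j = of_nat n" using v by (auto simp: Nats_def)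
    then obtain n where n: "\<And>j. j \<notin> I \<Longrightarrow> v $ j = of_nat (n j)" by metis
    have "\<exists>e>0. \<exists>M. \<forall>u\<in>kernel_lattice A. (\<forall>j. j \<notin> I \<longrightarrow> - int (n j) \<le> u $ j) \<longrightarrow>
        e * (\<Sum>j\<in>UNIV. \<bar>of_int (u $ j)\<bar>) - M \<le> w \<bullet> ivec u"
      by (rule weight_bound [OF ind c])
    then obtain e M where eM: "e > 0" "\<forall>u\<in>kernel_lattice A. (\<forall>j. j \<notin> I \<longrightarrow> - int (n j) \<le> u $ j) \<longrightarrow>
        e * (\<Sum>j\<in>UNIV. \<bar>of_int (u $ j)\<bar>) - M \<le> w \<bullet> ivec u" by blast
    have "- int (n j) \<le> u $ j" if j: "j \<notin> I" and vu: "(v + ivec u) $ j \<in> \<nat>" for u j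
    proof -
      obtain m where "(v + ivec u) $ j = of_nat m" using vu by (rule Nats_cases)
      then have "of_int (int (n j) + u $ j) = (of_int (int m) :: 'k)" using n [OF j] by simp
      then show ?thesis by (simp only: of_int_eq_iff)
    qed
    then show ?thesis using eM by blast
  qed
  \<comment> \<open>\<open>X\<close> are the translations that keep the coordinates outside \<open>I\<close> natural; \<open>Y\<close> are those among them
    that reach the minimal negative support \<open>K\<close>.\<close>
  define X where "X = {u\<in>kernel_lattice A. \<forall>j. j \<notin> I \<longrightarrow> (v0 + ivec u) $ j \<in> \<nat>}"
  have "0 \<in> X" using v0 by (simp add: X_def kernel_lattice_def)
  then obtain u1 where u1: "u1 \<in> X" "\<And>u. u \<in> X \<Longrightarrow> card (nsupp (v0 + ivec u1)) \<le> card (nsupp (v0 + ivec u))"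
    using ex_has_least_nat [of "\<lambda>u. u \<in> X" 0 "\<lambda>u. card (nsupp (v0 + ivec u))"] by blast
  define K where "K = nsupp (v0 + ivec u1)"
  have KI: "K \<subseteq> I"
  proof
    fix j assume "j \<in> K"
    then have "(v0 + ivec u1) $ j \<notin> \<nat>" unfolding K_def mem_nsupp by (auto simp: Nats_def)
    then show "j \<in> I" using u1(1) by (auto simp: X_def)
  qed
  have inX: "u \<in> X" if u: "u \<in> kernel_lattice A" "nsupp (v0 + ivec u) \<subseteq> K" for u
  proof -
    have "(v0 + ivec u) $ j \<in> \<nat>" if j: "j \<notin> I" for j
    proof -
      obtain n where "v0 $ j = of_nat n" using v0 [OF j] by (rule Nats_cases)
      then have eq: "(v0 + ivec u) $ j = of_int (int n + u $ j)" by simp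
      have "j \<notin> nsupp (v0 + ivec u)" using u(2) KI j by blast
      then have "int n + u $ j \<ge> 0" using eq by (rule not_in_nsuppD)
      then show ?thesis unfolding eq by (metis of_int_of_nat_eq of_nat_in_Nats zero_le_imp_eq_int)
    qed
    then show ?thesis using u(1) by (simp add: X_def)
  qed
  have inK: "nsupp (v0 + ivec u) = K" if u: "u \<in> kernel_lattice A" "nsupp (v0 + ivec u) \<subseteq> K" for u
    using u1(2) [OF inX [OF u]] u(2) unfolding K_def by (intro card_seteq) auto
  define Y where "Y = {u\<in>kernel_lattice A. nsupp (v0 + ivec u) = K}"
  have u1Y: "u1 \<in> Y" using u1(1) by (simp add: Y_def K_def X_def)
  obtain e M where eM: "e > 0" "\<And>u. u \<in> X \<Longrightarrow> e * (\<Sum>j\<in>UNIV. \<bar>of_int (u $ j)\<bar>) - M \<le> w \<bullet> ivec u"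
    using bound [OF v0] unfolding X_def by blast
  have "{u\<in>Y. w \<bullet> ivec u \<le> w \<bullet> ivec u1} \<subseteq> {u. (\<Sum>j\<in>UNIV. \<bar>of_int (u $ j)\<bar>) \<le> (w \<bullet> ivec u1 + M) / e}"
  proof (intro subsetI CollectI)
    fix u assume u: "u \<in> {u\<in>Y. w \<bullet> ivec u \<le> w \<bullet> ivec u1}"
    then have "u \<in> X" by (intro inX) (auto simp: Y_def)
    then show "(\<Sum>j\<in>UNIV. \<bar>of_int (u $ j)\<bar>) \<le> (w \<bullet> ivec u1 + M) / e"
      using eM(2) [of u] u eM(1) by (simp add: field_simps)
  qed
  then have "finite {u\<in>Y. w \<bullet> ivec u \<le> w \<bullet> ivec u1}"
    by (rule finite_subset) (rule finite_bounded_int_vec)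
  then obtain u2 where u2: "u2 \<in> Y" "\<And>u. u \<in> Y \<Longrightarrow> w \<bullet> ivec u2 \<le> w \<bullet> ivec u"
    using exists_minimizer [OF u1Y, of "\<lambda>u. w \<bullet> ivec u"] by blast
  define v where "v = v0 + ivec u2"
  have u2ker: "u2 \<in> kernel_lattice A" and nv: "nsupp v = K"
    using u2(1) by (auto simp: Y_def v_def)
  have shift: "v + ivec u = v0 + ivec (u2 + u)" for u
    by (simp add: v_def ivec_add)
  have ker_add: "u2 + u \<in> kernel_lattice A" if "u \<in> kernel_lattice A" for u
    using u2ker that by (simp add: kernel_lattice_def matrix_vector_right_distrib)
  have vmin: "minimal_nsupp A v"
    unfolding minimal_nsupp_def
  proof (intro ballI notI)
    fix u assume u: "u \<in> kernel_lattice A" "nsupp (v + ivec u) \<subset> nsupp v"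
    then have "nsupp (v + ivec u) = K"
      unfolding shift nv by (intro inK ker_add) auto
    then show False using u(2) nv by simp
  qed
  have vNat: "v $ j \<in> \<nat>" if "j \<notin> I" for j
    using inX [OF u2ker] nv that by (simp add: X_def v_def)
  have nonneg: "w \<bullet> ivec u \<ge> 0" if u: "u \<in> kernel_lattice A" "nsupp (v + ivec u) \<subseteq> K" for u
  proof -
    have "u2 + u \<in> Y"
      using inK [OF ker_add [OF u(1)]] u(2) ker_add [OF u(1)] by (simp add: Y_def shift)
    then show ?thesis using u2(2) [of "u2 + u"] by (simp add: ivec_add inner_add_right)
  qed
  have pos: "w \<bullet> ivec u > 0" if u: "u \<in> nsupp_class A v" "u \<noteq> 0" for u
  proof (rule ccontr)
    assume "\<not> w \<bullet> ivec u > 0"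
    moreover have ker: "u \<in> kernel_lattice A" and nu: "nsupp (v + ivec u) = K"
      using u(1) nv by (auto simp: nsupp_class_def)
    ultimately have wu: "w \<bullet> ivec u = 0" using nonneg by (simp add: order_antisym)
    obtain t where t: "A *v nvec t = A *v nvec (pos_part u)" "w \<bullet> nvec t < w \<bullet> nvec (pos_part u)"
      using gen ker u(2) wu by (rule generic_not_fiber_min)
    define u' :: "int^'n" where "u' = nvec t - nvec (neg_part u)"
    have u'ker: "u' \<in> kernel_lattice A"
      using t(1) matrix_nvec_pos_part [OF ker]
      by (simp add: u'_def kernel_lattice_def matrix_vector_mult_diff_distrib)
    have "nsupp (v + ivec u') \<subseteq> K"
    proof
      fix j assume "j \<in> nsupp (v + ivec u')"
      then obtain m where m: "m < 0" "v $ j + of_int (u' $ j) = of_int m" by (auto simp: nsupp_def)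
      show "j \<in> K"
      proof (cases "u $ j \<ge> 0")
        case True
        then have "u' $ j = int (t $ j)" by (simp add: u'_def neg_part_def)
        then have "v $ j = of_int (m - int (t $ j))" using m(2) by (simp add: algebra_simps)
        then show ?thesis
          unfolding nv [symmetric] nsupp_def using m(1) by (intro CollectI exI [of _ "m - int (t $ j)"]) auto
      next
        case False
        then have "u' $ j = int (t $ j) + u $ j" by (simp add: u'_def neg_part_def)
        then have "(v + ivec u) $ j = of_int (m - int (t $ j))" using m(2) by (simp add: algebra_simps)
        then show ?thesis
          unfolding nu [symmetric] nsupp_def using m(1) by (intro CollectI exI [of _ "m - int (t $ j)"]) auto
      qed
    qed
    then have "w \<bullet> ivec u' \<ge> 0" using u'ker by (intro nonneg)
    moreover have "ivec u' = nvec t - (nvec (neg_part u) :: real^'n)"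
      by (simp add: u'_def ivec_diff)
    moreover have "w \<bullet> nvec (pos_part u) - w \<bullet> nvec (neg_part u) = 0"
      using wu unfolding nvec_pos_minus_neg [symmetric] by (simp add: inner_diff_right)
    ultimately show False using t(2) by (simp add: inner_diff_right)
  qed
  obtain e1 M1 where e1: "e1 > 0"
    "\<And>u. u \<in> kernel_lattice A \<Longrightarrow> \<forall>j. j \<notin> I \<longrightarrow> (v + ivec u) $ j \<in> \<nat> \<Longrightarrow>
      e1 * (\<Sum>j\<in>UNIV. \<bar>of_int (u $ j)\<bar>) - M1 \<le> w \<bullet> ivec u"
    using bound [OF vNat] by blast
  have "e1 * (\<Sum>j\<in>UNIV. \<bar>of_int (u $ j)\<bar>) - M1 \<le> w \<bullet> ivec u" if u: "u \<in> nsupp_class A v" for u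
  proof (rule e1(2))
    show ker: "u \<in> kernel_lattice A" using u by (simp add: nsupp_class_def)
    have "nsupp (v0 + ivec (u2 + u)) \<subseteq> K"
      using u nv by (simp add: nsupp_class_def shift)
    then have "u2 + u \<in> X" by (rule inX [OF ker_add [OF ker]])
    then show "\<forall>j. j \<notin> I \<longrightarrow> (v + ivec u) $ j \<in> \<nat>"
      unfolding X_def shift by blast
  qed
  then obtain e2 where "e2 > 0" "\<And>u. u \<in> nsupp_class A v \<Longrightarrow> e2 * (\<Sum>j\<in>UNIV. \<bar>of_int (u $ j)\<bar>) \<le> w \<bullet> ivec u"
    using affine_bound_imp_linear_bound [of e1 "nsupp_class A v" M1 w] e1(1) pos by metis
  then show ?thesis
    using that [of u2 e2] u2ker vmin vNat unfolding v_def by blast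
qed

section \<open>Counting classes of exponents\<close>

lemma group_closure_ivec:
  "group_closure (ivec ` S) = (ivec ` group_closure S :: ('a::ring_1^'n) set)"
proof (intro equalityI subsetI)
  fix x :: "'a^'n" assume "x \<in> group_closure (ivec ` S)"
  then show "x \<in> ivec ` group_closure S"
  proof induction
    case (base s)
    show ?case
    proof (cases "s = 0")
      case True
      then show ?thesis by (metis imageI ivec_0 zero_in_group_closure)
    next
      case False
      then show ?thesis using base by (auto intro: group_closure.base)
    qed
  next
    case (diff s t)
    then obtain a b where "a \<in> group_closure S" "s = ivec a" "b \<in> group_closure S" "t = ivec b"
      by blast
    then show ?case
      by (intro image_eqI [of _ _ "a - b"]) (simp_all add: ivec_diff group_closure.diff)
  qed
next
  fix x :: "'a^'n" assume "x \<in> ivec ` group_closure S"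
  then obtain y where "y \<in> group_closure S" "x = ivec y" by auto
  moreover have "ivec y \<in> group_closure (ivec ` S)" if "y \<in> group_closure S" for y
    using that
  proof induction
    case (base s)
    show ?case
    proof (cases "s = 0")
      case False
      then show ?thesis using base by (intro group_closure.base) auto
    qed simp
  next
    case (diff s t)
    then show ?case by (simp add: ivec_diff group_closure.diff)
  qed
  ultimately show "x \<in> group_closure (ivec ` S)" by simp
qed

lemma group_closure_mono:
  assumes "S \<subseteq> T"
  shows "group_closure S \<subseteq> group_closure T"
proof
  fix x assume "x \<in> group_closure S"
  then show "x \<in> group_closure T"
    by induction (use assms in \<open>auto intro: group_closure.intros\<close>)
qed

lemma group_closure_sum:
  "(\<And>i. i \<in> S \<Longrightarrow> f i \<in> group_closure T) \<Longrightarrow> sum f S \<in> group_closure T"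
  by (induction S rule: infinite_finite_induct) (auto intro: group_closure_add)

lemma group_closure_int_scale:
  assumes "x \<in> group_closure T"
  shows "m *s x \<in> group_closure (T :: (int^'n) set)"
proof (induction m rule: int_induct [of _ 0])
  case (step1 i)
  have "(i + 1) *s x = i *s x + x" by (simp add: vec_eq_iff algebra_simps)
  then show ?case using step1 assms by (simp add: group_closure_add)
next
  case (step2 i)
  have "(i - 1) *s x = i *s x - x" by (simp add: vec_eq_iff algebra_simps)
  then show ?case using step2 assms by (simp add: group_closure.diff)
qed simp

lemma matrix_mult_in_group_closure:
  fixes A :: "int^'n::finite^'d"
  assumes "\<And>j. j \<notin> I \<Longrightarrow> z $ j = 0"
  shows "A *v z \<in> group_closure ((\<lambda>j. column j A) ` I)"
proof -
  have "A *v z = (\<Sum>j\<in>UNIV. z $ j *s column j A)"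
    by (rule matrix_mult_sum)
  also have "\<dots> \<in> group_closure ((\<lambda>j. column j A) ` I)"
  proof (rule group_closure_sum)
    fix j
    show "z $ j *s column j A \<in> group_closure ((\<lambda>j. column j A) ` I)"
      using assms [of j] by (cases "j \<in> I") (auto intro: group_closure_int_scale group_closure.base)
  qed
  finally show ?thesis .
qed

lemma group_closure_columns:
  fixes A :: "int^'n::finite^'d"
  assumes "x \<in> group_closure ((\<lambda>j. column j A) ` I)"
  obtains z where "\<And>j. j \<notin> I \<Longrightarrow> z $ j = 0" "x = A *v z"
proof -
  have "\<exists>z. (\<forall>j. j \<notin> I \<longrightarrow> z $ j = 0) \<and> x = A *v z"
    using assms
  proof induction
    case (base s)
    show ?case
    proof (cases "s = 0")
      case True
      then show ?thesis by (intro exI [of _ 0]) simp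
    next
      case False
      then obtain i where i: "i \<in> I" "s = column i A" using base by auto
      have "axis i 1 $ j = (0 :: int)" if "j \<notin> I" for j
        using that i(1) by (auto simp: axis_def)
      moreover have "A *v axis i 1 = column i A"
        by (simp add: vec_eq_iff matrix_vector_mult_def column_def axis_def if_distrib cong: if_cong)
      ultimately show ?thesis
        using i(2) by (intro exI [of _ "axis i 1"]) simp
    qed
  next
    case (diff s t)
    then obtain y z where "\<forall>j. j \<notin> I \<longrightarrow> y $ j = 0" "s = A *v y" "\<forall>j. j \<notin> I \<longrightarrow> z $ j = 0" "t = A *v z"
      by blast
    then show ?case by (intro exI [of _ "y - z"]) (simp add: matrix_vector_mult_diff_distrib)
  qed
  then show ?thesis using that by blast
qed

lemma finite_quotient_torsion:
  fixes G H :: "(int^'d) set"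
  assumes "finite ((\<lambda>z. z +o group_closure S) ` G)" "\<And>m::int. m *s g \<in> G"
  obtains m :: nat where "m > 0" "int m *s g \<in> group_closure S"
proof -
  let ?q = "\<lambda>m::nat. (int m *s g) +o group_closure S"
  have "finite (range ?q)"
    by (rule finite_subset [OF _ assms(1)]) (use assms(2) in auto)
  then have "\<not> inj ?q" using finite_imageD infinite_UNIV_nat by blast
  then obtain a b where ab: "a < b" "?q a = ?q b"
    unfolding inj_def by (metis linorder_neqE_nat)
  have "int b *s g \<in> ?q a"
    unfolding ab(2) by (metis add.right_neutral set_plus_intro2 zero_in_group_closure)
  then obtain h where h: "h \<in> group_closure S" "int b *s g = int a *s g + h"
    by (auto simp: elt_set_plus_def)
  have "int (b - a) *s g = int b *s g - int a *s g"
    using ab(1) by (simp add: vec_eq_iff of_nat_diff algebra_simps)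
  then have "int (b - a) *s g = h"
    using h(2) by simp
  then show ?thesis using that [of "b - a"] h(1) ab(1) by simp
qed

lemma coset_eq_iff:
  "a +o group_closure S = b +o group_closure S \<longleftrightarrow> a - b \<in> group_closure S"
proof
  assume eq: "a +o group_closure S = b +o group_closure S"
  have "a \<in> a +o group_closure S"
    by (metis add.right_neutral set_plus_intro2 zero_in_group_closure)
  then show "a - b \<in> group_closure S" unfolding eq by (auto simp: elt_set_plus_def)
next
  have sub: "x +o group_closure S \<subseteq> y +o group_closure S" if "x - y \<in> group_closure S" for x y
  proof
    fix z assume "z \<in> x +o group_closure S"
    then obtain h where h: "h \<in> group_closure S" "z = x + h" by (auto simp: elt_set_plus_def)
    have "z = y + (x - y + h)" using h(2) by simp
    moreover have "x - y + h \<in> group_closure S" using that h(1) by (rule group_closure_add)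
    ultimately show "z \<in> y +o group_closure S" by (metis set_plus_intro2)
  qed
  assume "a - b \<in> group_closure S"
  moreover from this have "b - a \<in> group_closure S" by (metis group_closure_minus_iff minus_diff_eq)
  ultimately show "a +o group_closure S = b +o group_closure S" using sub by blast
qed

text \<open>Suppose that the columns in \<open>I\<close> generate a subgroup of finite index in the group generated by all
columns on the face.  Then every column on the face has a positive multiple in that subgroup.\<close>

context
  fixes A :: "int^'n::finite^'d::finite" and I :: "'n set"
  assumes fin: "finite ((\<lambda>z. z +o group_closure ((\<lambda>i. column i A) ` I)) `
     group_closure ((\<lambda>j. column j A) ` face_indices A I))"
begin

lemma face_index_torsion:
  assumes "j \<in> face_indices A I"
  obtains m z where "m > 0" "\<And>i. i \<notin> I \<Longrightarrow> z $ i = 0" "int m *s column j A = A *v z"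
proof -
  have "k *s column j A \<in> group_closure ((\<lambda>j. column j A) ` face_indices A I)" for k
    using assms by (intro group_closure_int_scale group_closure.base) auto
  then obtain m where m: "m > 0" "int m *s column j A \<in> group_closure ((\<lambda>i. column i A) ` I)"
    using finite_quotient_torsion [OF fin] by metis
  then show ?thesis using that group_closure_columns [OF m(2)] by metis
qed

text \<open>Modulo the group generated by the columns in \<open>I\<close>, every element of the group of the face lies in the
monoid generated by the columns.\<close>

lemma face_group_nonneg:
  assumes "g \<in> group_closure ((\<lambda>j. column j A) ` face_indices A I)"
  obtains t z where "\<And>i. i \<notin> I \<Longrightarrow> z $ i = 0" "g = A *v (nvec t + z)"
proof -
  define P where "P g \<longleftrightarrow> (\<exists>t z. (\<forall>i. i \<notin> I \<longrightarrow> z $ i = 0) \<and> g = A *v (nvec t + z))" for g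
  have P_add: "P (g + h)" if g: "P g" and h: "P h" for g h
  proof -
    obtain t z where "\<forall>i. i \<notin> I \<longrightarrow> z $ i = 0" "g = A *v (nvec t + z)"
      using g unfolding P_def by blast
    moreover obtain t' z' where "\<forall>i. i \<notin> I \<longrightarrow> z' $ i = 0" "h = A *v (nvec t' + z')"
      using h unfolding P_def by blast
    ultimately show ?thesis
      unfolding P_def
      by (intro exI [of _ "t + t'"] exI [of _ "z + z'"]) (simp add: nvec_add matrix_vector_right_distrib)
  qed
  have "P g \<and> P (- g)"
    using assms
  proof induction
    case (base s)
    show ?case
    proof (cases "s = 0")
      case True
      have "P 0" unfolding P_def by (intro exI [of _ 0]) simp
      then show ?thesis using True by simp
    next
      case False
      then obtain j where j: "j \<in> face_indices A I" "s = column j A" using base by auto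
      have col: "A *v nvec (axis j n) = int n *s column j A" for n
        unfolding matrix_mult_sum [of A]
        by (subst sum.remove [of _ j]) (auto simp: axis_def intro!: sum.neutral)
      obtain m z where m: "m > 0" "\<And>i. i \<notin> I \<Longrightarrow> z $ i = 0" "int m *s column j A = A *v z"
        using face_index_torsion [OF j(1)] by metis
      have "P s"
        unfolding P_def by (intro exI [of _ "axis j 1"] exI [of _ 0]) (simp add: col j(2))
      moreover have "A *v (nvec (axis j (m - 1)) - z) = - s"
        using m(1) unfolding matrix_vector_mult_diff_distrib col m(3) [symmetric] j(2)
        by (simp add: vec_eq_iff of_nat_diff algebra_simps)
      then have "A *v (nvec (axis j (m - 1)) + - z) = - s" by simp
      then have "P (- s)"
        unfolding P_def using m(2) by (intro exI [of _ "axis j (m - 1)"] exI [of _ "- z"]) simp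
      ultimately show ?thesis ..
    qed
  next
    case (diff s t)
    then show ?case using P_add [of s "- t"] P_add [of "- s" t] by simp
  qed
  then show ?thesis unfolding P_def using that by blast
qed

lemma face_space_preimage:
  fixes \<mu> :: "'k::field_char_0^'d"
  assumes "\<mu> \<in> face_space A I"
  obtains y where "\<And>i. i \<notin> I \<Longrightarrow> y $ i = 0" "imat A *v y = \<mu>"
proof -
  let ?S = "{imat A *v y | y :: 'k^'n. \<forall>i. i \<notin> I \<longrightarrow> y $ i = 0}"
  have "vec.subspace ?S"
  proof (rule vec.subspaceI)
    show "0 \<in> ?S" by (intro CollectI exI [of _ 0]) simp
    fix x x' assume "x \<in> ?S" "x' \<in> ?S"
    then obtain y y' :: "'k^'n" where "\<forall>i. i \<notin> I \<longrightarrow> y $ i = 0" "x = imat A *v y"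
      "\<forall>i. i \<notin> I \<longrightarrow> y' $ i = 0" "x' = imat A *v y'" by blast
    then show "x + x' \<in> ?S"
      by (intro CollectI exI [of _ "y + y'"]) (simp add: matrix_vector_right_distrib)
  next
    fix c :: 'k and x assume "x \<in> ?S"
    then obtain y :: "'k^'n" where "\<forall>i. i \<notin> I \<longrightarrow> y $ i = 0" "x = imat A *v y" by blast
    then show "c *s x \<in> ?S"
      by (intro CollectI exI [of _ "c *s y"]) (simp add: vec.scale)
  qed
  moreover have "(\<lambda>j. ivec (column j A)) ` face_indices A I \<subseteq> ?S"
  proof (rule image_subsetI)
    fix j assume j: "j \<in> face_indices A I"
    obtain m z where m: "m > 0" "\<And>i. i \<notin> I \<Longrightarrow> z $ i = 0" "int m *s column j A = A *v z"
      using face_index_torsion [OF j] by metis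
    have "imat A *v (ivec z :: 'k^'n) = of_nat m *s ivec (column j A)"
      unfolding imat_ivec m(3) [symmetric] by (simp add: vec_eq_iff)
    then have "imat A *v ((1 / of_nat m) *s (ivec z :: 'k^'n)) = ivec (column j A)"
      using m(1) by (simp add: vec.scale)
    then show "ivec (column j A) \<in> ?S"
      using m(2) by (intro CollectI exI [of _ "(1 / of_nat m) *s ivec z"]) simp
  qed
  ultimately have "face_space A I \<subseteq> ?S"
    unfolding face_space_def by (rule vec.span_minimal [rotated])
  then show ?thesis using assms that by blast
qed

lemma face_group_eq:
  "face_group A I = ivec ` group_closure ((\<lambda>j. column j A) ` face_indices A I)"
  unfolding face_group_def group_closure_ivec [symmetric] image_image ..

lemma face_group_subset_face_space: "face_group A I \<subseteq> (face_space A I :: ('k::field^'d) set)"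
proof
  fix x :: "'k::field^'d" assume "x \<in> face_group A I"
  then show "x \<in> face_space A I"
    unfolding face_group_def face_space_def
    by induction (auto intro: vec.span_base vec.span_zero vec.span_diff)
qed

text \<open>The vector \<open>y\<close> records the position of \<open>\<mu> + g\<close> in the space spanned by the columns in \<open>I\<close>; modulo
integer vectors it is the class of \<open>v\<close>.\<close>

lemma exists_fiber_point:
  fixes \<beta> \<mu> :: "'k::field_char_0^'d"
  assumes \<mu>: "\<mu> \<in> face_space A I" "\<beta> - \<mu> \<in> monoid_of A + face_group A I"
    and g: "g \<in> group_closure ((\<lambda>j. column j A) ` face_indices A I)"
  obtains v y z where "imat A *v v = \<beta>" "\<And>i. i \<notin> I \<Longrightarrow> v $ i \<in> \<nat>" "v = y + ivec z"
    "\<And>i. i \<notin> I \<Longrightarrow> y $ i = 0" "imat A *v y = \<mu> + ivec g"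
proof -
  have "\<mu> + ivec g \<in> face_space A I"
    using \<mu>(1) g face_group_subset_face_space unfolding face_space_def face_group_eq
    by (intro vec.span_add) auto
  then obtain y where y: "\<And>i. i \<notin> I \<Longrightarrow> y $ i = 0" "imat A *v y = \<mu> + ivec g"
    using face_space_preimage by metis
  obtain t g' where t: "g' \<in> group_closure ((\<lambda>j. column j A) ` face_indices A I)"
    "\<beta> - \<mu> = imat A *v nvec t + ivec g'"
    using \<mu>(2) by (auto simp: monoid_of_def face_group_eq set_plus_def)
  obtain s z where s: "\<And>i. i \<notin> I \<Longrightarrow> z $ i = 0" "g' - g = A *v (nvec s + z)"
    using face_group_nonneg [OF group_closure.diff [OF t(1) g]] by metis
  let ?z = "nvec t + (nvec s + z)"
  have "ivec ?z = nvec t + (ivec (nvec s + z) :: 'k^'n)"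
    by (simp add: ivec_add)
  then have "imat A *v (y + ivec ?z) = \<mu> + ivec g + (imat A *v nvec t + ivec (g' - g))"
    unfolding s(2) by (simp only: matrix_vector_right_distrib y(2) imat_ivec)
  also have "\<dots> = \<beta>"
    using t(2) by (simp add: ivec_diff algebra_simps)
  finally have "imat A *v (y + ivec ?z) = \<beta>" .
  moreover have "(y + ivec ?z) $ i \<in> \<nat>" if "i \<notin> I" for i
    using y(1) [OF that] s(1) [OF that] by simp
  ultimately show ?thesis using that y by blast
qed

end

lemma subset_face_indices: "I \<subseteq> face_indices A I"
  by (auto simp: face_indices_def intro: hull_inc)

text \<open>Membership in \<open>E_set\<close> comes for free: the part of \<open>\<beta> = Av\<close> off the face lies in the monoid.\<close>

lemma fiber_point_class:
  fixes v :: "'k::field_char_0^'n::finite" and A :: "int^'n^'d::finite"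
  assumes v: "imat A *v v = \<beta>" "\<And>j. j \<notin> I \<Longrightarrow> v $ j \<in> \<nat>"
  shows "(\<Sum>j\<in>face_indices A I. v $ j *s ivec (column j A)) +o face_group A I \<in> E_set A I \<beta>"
proof -
  let ?J = "face_indices A I"
  let ?\<mu> = "\<Sum>j\<in>?J. v $ j *s ivec (column j A)"
  have col: "column j (imat A) = (ivec (column j A) :: 'k^'d)" for j
    by (simp add: vec_eq_iff column_def imat_def map_matrix_def)
  have "\<exists>t. \<forall>j. (if j \<in> ?J then 0 else v $ j) = of_nat (t j)"
  proof (rule choice, rule allI)
    fix j
    show "\<exists>t. (if j \<in> ?J then 0 else v $ j) = of_nat t"
    proof (cases "j \<in> ?J")
      case True
      then show ?thesis by (intro exI [of _ 0]) simp
    next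
      case False
      then have "v $ j \<in> \<nat>" using v(2) subset_face_indices by blast
      then show ?thesis using False by (auto elim: Nats_cases)
    qed
  qed
  then obtain t where t: "\<And>j. (if j \<in> ?J then 0 else v $ j) = of_nat (t j)" by blast
  have "\<beta> = ?\<mu> + (\<Sum>j\<in>-?J. v $ j *s ivec (column j A))"
    unfolding v(1) [symmetric] matrix_mult_sum col Compl_eq_Diff_UNIV
    using sum.subset_diff [of ?J UNIV "\<lambda>j. v $ j *s ivec (column j A)"] by (simp add: add.commute)
  also have "(\<Sum>j\<in>-?J. v $ j *s (ivec (column j A) :: 'k^'d)) =
      (\<Sum>j\<in>UNIV. of_nat (t j) *s ivec (column j A))"
  proof (rule sum.mono_neutral_cong_left)
    show "\<forall>j\<in>UNIV - - ?J. of_nat (t j) *s (ivec (column j A) :: 'k^'d) = 0"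
      using t by (simp flip: t)
    show "v $ j *s (ivec (column j A) :: 'k^'d) = of_nat (t j) *s ivec (column j A)" if "j \<in> - ?J" for j
      using that by (simp flip: t)
  qed auto
  also have "\<dots> = imat A *v nvec (\<chi> j. t j)"
    unfolding matrix_mult_sum col by simp
  finally have eq: "\<beta> - ?\<mu> = imat A *v nvec (\<chi> j. t j) + 0" by simp
  have "\<beta> - ?\<mu> \<in> monoid_of A + face_group A I"
    unfolding eq by (rule set_plus_intro) (auto simp: monoid_of_def face_group_def)
  moreover have "?\<mu> \<in> face_space A I"
    unfolding face_space_def by (intro vec.span_sum vec.span_scale vec.span_base) auto
  ultimately show ?thesis unfolding E_set_def by blast
qed

section \<open>The logarithm-free canonical series of a face\<close>

theorem theorem3p1:
  fixes A :: "int^('n::{finite,linorder})^('d::finite)"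
    and \<beta> :: "('k::field_char_0)^'d"
    and w :: "real^('n::{finite,linorder})"
    and I :: "'n set"
  assumes "rank (imat A :: rat^('n::{finite,linorder})^('d::finite)) = CARD('d)"
    and "on_hyperplane_off_origin A"
    and "w \<noteq> 0"
    and "generic_weight A \<beta> w"
    and "I \<in> regular_faces A w"
  shows "\<exists>F. finite F \<and> card F \<ge> card (E_set A I \<beta>) * face_vol A I \<and>
    (\<forall>f\<in>F. \<exists>v. f = phi A v \<and> imat A *v v = \<beta> \<and> minimal_nsupp A v \<and>
       canonical A \<beta> w v f \<and> log_free f \<and>
       (\<Sum>j\<in>face_indices A I. v $ j *s ivec (column j A)) +o face_group A I \<in> E_set A I \<beta> \<and>
       nsupp v \<subseteq> I \<and> {j. v $ j \<notin> \<int>} \<subseteq> I)"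
proof (cases "card (E_set A I \<beta>) * face_vol A I = 0")
  case True
  \<comment> \<open>This case includes an infinite set \<open>E_set\<close> or an infinite index, where the cardinality is \<open>0\<close> by
    convention.\<close>
  then show ?thesis by (intro exI [of _ "{}"]) simp
next
  case False
  let ?G = "group_closure ((\<lambda>j. column j A) ` face_indices A I)"
  let ?H = "group_closure ((\<lambda>i. column i A) ` I)"
  let ?Q = "(\<lambda>z. z +o ?H) ` ?G"
  define good where "good v \<longleftrightarrow> imat A *v v = \<beta> \<and> minimal_nsupp A v \<and>
       canonical A \<beta> w v (phi A v) \<and> (\<forall>j. j \<notin> I \<longrightarrow> v $ j \<in> \<nat>)" for v :: "('k, 'n) vec"
  have fin: "finite ?Q" "finite (E_set A I \<beta>)" and card: "face_vol A I = card ?Q"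
    using False by (auto simp: face_vol_def intro: card_ge_0_finite)
  have "\<forall>C\<in>E_set A I \<beta>. \<exists>\<mu>. C = \<mu> +o face_group A I \<and> \<mu> \<in> face_space A I \<and>
      \<beta> - \<mu> \<in> monoid_of A + face_group A I"
    by (auto simp: E_set_def)
  then obtain \<mu> where \<mu>: "\<And>C. C \<in> E_set A I \<beta> \<Longrightarrow> C = \<mu> C +o face_group A I \<and> \<mu> C \<in> face_space A I \<and>
      \<beta> - \<mu> C \<in> monoid_of A + face_group A I"
    by metis
  have "\<exists>v y z g. good v \<and> v = y + ivec z \<and> (\<forall>i. i \<notin> I \<longrightarrow> y $ i = 0) \<and>
      g \<in> ?G \<and> q = g +o ?H \<and> imat A *v y = \<mu> C + ivec g"
    if C: "C \<in> E_set A I \<beta>" and q: "q \<in> ?Q" for C q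
  proof -
    obtain g where g: "g \<in> ?G" "q = g +o ?H" using q by blast
    obtain v0 y z where v0: "imat A *v v0 = \<beta>" "\<And>i. i \<notin> I \<Longrightarrow> v0 $ i \<in> \<nat>" "v0 = y + ivec z"
      "\<And>i. i \<notin> I \<Longrightarrow> y $ i = 0" "imat A *v y = \<mu> C + ivec g"
      using exists_fiber_point [OF fin(1) _ _ g(1), of "\<mu> C" \<beta>] \<mu> [OF C] by metis
    obtain u e where u: "u \<in> kernel_lattice A" "minimal_nsupp A (v0 + ivec u)"
      "\<And>j. j \<notin> I \<Longrightarrow> (v0 + ivec u) $ j \<in> \<nat>" "e > 0"
      "\<And>u'. u' \<in> nsupp_class A (v0 + ivec u) \<Longrightarrow> e * (\<Sum>j\<in>UNIV. \<bar>of_int (u' $ j)\<bar>) \<le> w \<bullet> ivec u'"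
      using exists_minimal_exponent [OF assms(4,2,5) v0(2)] by metis
    let ?v = "v0 + ivec u"
    have v: "imat A *v ?v = \<beta>"
      using v0(1) u(1) by (simp add: matrix_vector_right_distrib imat_ivec kernel_lattice_def)
    have pos: "w \<bullet> ivec u' > 0" if "u' \<in> nsupp_class A ?v" "u' \<noteq> 0" for u'
    proof -
      have "\<exists>j. u' $ j \<noteq> 0" using that(2) by (simp add: vec_eq_iff)
      then obtain j where "u' $ j \<noteq> 0" ..
      then have "(\<Sum>j\<in>UNIV. \<bar>of_int (u' $ j) :: real\<bar>) > 0" by (intro sum_pos2 [of _ j]) auto
      then have "e * (\<Sum>j\<in>UNIV. \<bar>of_int (u' $ j)\<bar>) > 0" using u(4) by simp
      then show ?thesis using u(5) [OF that(1)] by linarith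
    qed
    have "canonical A \<beta> w ?v (phi A ?v)"
      using canonical_phi [OF u(2) v pos in_direction_phi [OF assms(3) u(4,5)]] .
    then have "good ?v" using u(2,3) v by (simp add: good_def)
    moreover have "?v = y + ivec (z + u)" by (simp add: v0(3) ivec_add)
    ultimately show ?thesis using v0(4,5) g by blast
  qed
  then have "\<forall>p\<in>E_set A I \<beta> \<times> ?Q. \<exists>v y z g. good v \<and> v = y + ivec z \<and> (\<forall>i. i \<notin> I \<longrightarrow> y $ i = 0) \<and>
      g \<in> ?G \<and> snd p = g +o ?H \<and> imat A *v y = \<mu> (fst p) + ivec g"
    by (auto simp del: ex_simps)
  then obtain V where V: "\<And>p. p \<in> E_set A I \<beta> \<times> ?Q \<Longrightarrow> \<exists>y z g. good (V p) \<and> V p = y + ivec z \<and>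
      (\<forall>i. i \<notin> I \<longrightarrow> y $ i = 0) \<and> g \<in> ?G \<and> snd p = g +o ?H \<and> imat A *v y = \<mu> (fst p) + ivec g"
    by metis
  define F where "F = (\<lambda>p. phi A (V p)) ` (E_set A I \<beta> \<times> ?Q)"
  \<comment> \<open>From \<open>phi A v\<close> the exponent \<open>v\<close> can be read off modulo the kernel lattice, hence \<open>y\<close> modulo integer
    vectors supported on \<open>I\<close>, hence \<open>\<mu> C + g\<close> modulo the group generated by the columns in \<open>I\<close>.\<close>
  have "inj_on (\<lambda>p. phi A (V p)) (E_set A I \<beta> \<times> ?Q)"
  proof (rule inj_onI)
    fix p p' assume p: "p \<in> E_set A I \<beta> \<times> ?Q" and p': "p' \<in> E_set A I \<beta> \<times> ?Q"
      and eq: "phi A (V p) = phi A (V p')"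
    obtain y z g where y: "V p = y + ivec z" "\<And>i. i \<notin> I \<Longrightarrow> y $ i = 0" "g \<in> ?G" "snd p = g +o ?H"
      "imat A *v y = \<mu> (fst p) + ivec g"
      using V [OF p] by metis
    obtain y' z' g' where y': "V p' = y' + ivec z'" "\<And>i. i \<notin> I \<Longrightarrow> y' $ i = 0" "g' \<in> ?G"
      "snd p' = g' +o ?H" "imat A *v y' = \<mu> (fst p') + ivec g'"
      using V [OF p'] by metis
    have "phi A (V p') (V p) = const 1"
      using phi_start [of A "V p"] eq by simp
    then have "phi_coeff A (V p') (V p) \<noteq> 0" by (metis const_eq_0_iff phi_eq zero_neq_one)
    then obtain u where "V p = V p' + ivec u" by (rule phi_coeff_nonzeroE)
    then have yz: "y - y' = ivec (u + z' - z)"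
      by (simp add: y(1) y'(1) ivec_add ivec_diff algebra_simps)
    have "(u + z' - z) $ i = 0" if "i \<notin> I" for i
    proof -
      have "ivec (u + z' - z) $ i = (0 :: 'k)"
        using y(2) [OF that] y'(2) [OF that] by (simp flip: yz)
      then show ?thesis by (metis ivec_nth of_int_eq_0_iff)
    qed
    then have H: "A *v (u + z' - z) \<in> ?H" by (rule matrix_mult_in_group_closure)
    have "imat A *v (y - y') = \<mu> (fst p) + ivec g - (\<mu> (fst p') + ivec g')"
      by (simp only: matrix_vector_mult_diff_distrib y(5) y'(5))
    then have "ivec (A *v (u + z' - z)) = \<mu> (fst p) + ivec g - (\<mu> (fst p') + ivec g')"
      unfolding yz imat_ivec .
    then have diff: "\<mu> (fst p) - \<mu> (fst p') = ivec (A *v (u + z' - z) - (g - g'))"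
      unfolding ivec_diff [of "A *v (u + z' - z)"] ivec_diff [of g] by (simp only:) (simp add: algebra_simps)
    have "?H \<subseteq> ?G"
      by (intro group_closure_mono image_mono subset_face_indices)
    then have "A *v (u + z' - z) - (g - g') \<in> ?G"
      using H y(3) y'(3) by (intro group_closure.diff) auto
    then have "\<mu> (fst p) - \<mu> (fst p') \<in> face_group A I"
      unfolding diff face_group_eq [OF fin(1)] by (rule imageI)
    then have "\<mu> (fst p) +o face_group A I = \<mu> (fst p') +o face_group A I"
      unfolding face_group_def coset_eq_iff .
    moreover have "fst p \<in> E_set A I \<beta>" "fst p' \<in> E_set A I \<beta>" using p p' by auto
    ultimately have fst: "fst p = fst p'" using \<mu> by metis
    then have "ivec (A *v (u + z' - z) - (g - g')) = (ivec 0 :: 'k^'d)" using diff by simp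
    then have "g - g' = A *v (u + z' - z)" unfolding ivec_eq_iff by simp
    then have "g - g' \<in> ?H" using H by simp
    then have "snd p = snd p'" unfolding y(4) y'(4) coset_eq_iff .
    then show "p = p'" using fst by (simp add: prod_eq_iff)
  qed
  then have "card F = card (E_set A I \<beta>) * face_vol A I"
    unfolding F_def card by (simp add: card_image card_cartesian_product)
  moreover have "finite F" unfolding F_def using fin by simp
  moreover have "\<exists>v. f = phi A v \<and> imat A *v v = \<beta> \<and> minimal_nsupp A v \<and>
       canonical A \<beta> w v f \<and> log_free f \<and>
       (\<Sum>j\<in>face_indices A I. v $ j *s ivec (column j A)) +o face_group A I \<in> E_set A I \<beta> \<and>
       nsupp v \<subseteq> I \<and> {j. v $ j \<notin> \<int>} \<subseteq> I" if fF: "f \<in> F" for f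
  proof -
    obtain p where p: "p \<in> E_set A I \<beta> \<times> ?Q" "f = phi A (V p)"
      using fF unfolding F_def by (rule imageE)
    define v where "v = V p"
    have f: "f = phi A v" using p(2) by (simp add: v_def)
    have v: "good v" using V [OF p(1)] unfolding v_def by blast
    have "nsupp v \<subseteq> I"
    proof
      fix j assume "j \<in> nsupp v"
      then have "v $ j \<notin> \<nat>" unfolding mem_nsupp by (auto simp: Nats_def)
      then show "j \<in> I" using v by (auto simp: good_def)
    qed
    moreover have "{j. v $ j \<notin> \<int>} \<subseteq> I"
      using v Nats_subset_Ints by (auto simp: good_def)
    moreover have "log_free f"
      unfolding log_free_def f phi_eq by blast
    ultimately show ?thesis
      using v fiber_point_class [of A v \<beta> I] unfolding good_def f by blast
  qed
  ultimately show ?thesis by (intro exI [of _ F]) simp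
qed

end
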